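(* If $G$ is a $P_4$-sparse graph, then $\mathrm{hn}_{cc}(G)$ can be computed in linear time (in the size of $G$).
   Context: Graphs are finite and simple. A graph is $P_4$-sparse if every set of $5$ vertices induces at most one path on $4$ vertices. A cycle is a closed walk $(v_1,\dots,v_q,v_1)$ with at least one edge in which the only repeated vertex is $v_1$. For $S\subseteq V(G)$ let $I_{cc}(S)=S\cup\{v\in V(G): \text{there is a cycle } C \text{ of } G \text{ with } V(C)\setminus S=\{v\}\}$. A set $S$ is convex if $I_{cc}(S)=S$; $\mathrm{hull}(S)$ is the smallest convex set containing $S$; $S$ is a hull set if $\mathrm{hull}(S)=V(G)$; $\mathrm{hn}_{cc}(G)$ is the minimum cardinality of a hull set of $G$. *)

theory Defs
  imports Complex_Main
begin

section \<open>Graphs, cycles and \<open>P\<^sub>4\<close>-sparse graphs\<close>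

record 'a ugraph =
  verts :: "'a set"
  edges :: "'a set set"

definition simple_graph :: "'a ugraph \<Rightarrow> bool" where
  "simple_graph G \<longleftrightarrow> finite (verts G) \<and> (\<forall>e\<in>edges G. e \<subseteq> verts G \<and> card e = 2)"

definition adjacent :: "'a ugraph \<Rightarrow> 'a \<Rightarrow> 'a \<Rightarrow> bool" where
  "adjacent G u v \<longleftrightarrow> {u, v} \<in> edges G"

text \<open>The list omits the return to its first vertex. The lower bound on the length excludes
  the closed walk that traverses a single edge back and forth, which is not a cycle of a
  simple graph.\<close>

definition is_cycle :: "'a ugraph \<Rightarrow> 'a list \<Rightarrow> bool" where
  "is_cycle G p \<longleftrightarrow> 3 \<le> length p \<and> distinct p \<and> set p \<subseteq> verts G \<and>
     (\<forall>i<length p. adjacent G (p ! i) (p ! (Suc i mod length p)))"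

definition induces_P4 :: "'a ugraph \<Rightarrow> 'a set \<Rightarrow> bool" where
  "induces_P4 G W \<longleftrightarrow> (\<exists>a b c d. distinct [a, b, c, d] \<and> W = {a, b, c, d} \<and> W \<subseteq> verts G \<and>
     adjacent G a b \<and> adjacent G b c \<and> adjacent G c d \<and>
     \<not> adjacent G a c \<and> \<not> adjacent G a d \<and> \<not> adjacent G b d)"

definition P4_sparse :: "'a ugraph \<Rightarrow> bool" where
  "P4_sparse G \<longleftrightarrow>
     (\<forall>U. U \<subseteq> verts G \<and> card U = 5 \<longrightarrow> card {W. W \<subseteq> U \<and> induces_P4 G W} \<le> 1)"


section \<open>Cycle convexity\<close>

definition interval_cc :: "'a ugraph \<Rightarrow> 'a set \<Rightarrow> 'a set" where
  "interval_cc G S = S \<union> {v \<in> verts G. \<exists>p. is_cycle G p \<and> set p - S = {v}}"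

definition convex_cc :: "'a ugraph \<Rightarrow> 'a set \<Rightarrow> bool" where
  "convex_cc G S \<longleftrightarrow> S \<subseteq> verts G \<and> interval_cc G S = S"

definition hull_cc :: "'a ugraph \<Rightarrow> 'a set \<Rightarrow> 'a set" where
  "hull_cc G S = convex_cc G hull S"

lemma convex_cc_hull_cc:
  assumes "S \<subseteq> verts G"
  shows "convex_cc G (hull_cc G S)"
proof -
  let ?F = "{T. convex_cc G T \<and> S \<subseteq> T}"
  have V: "verts G \<in> ?F"
    using assms by (auto simp: convex_cc_def interval_cc_def)
  have "v \<in> \<Inter>?F"
    if v: "is_cycle G p" "v \<in> verts G" "set p - \<Inter>?F = {v}" for v p
  proof
    fix T assume T: "T \<in> ?F"
    show "v \<in> T"
    proof (rule ccontr)
      assume "v \<notin> T"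
      then have "set p - T = {v}"
        using v(3) T by auto
      then have "v \<in> interval_cc G T"
        using v(1,2) by (auto simp: interval_cc_def)
      then show False
        using T \<open>v \<notin> T\<close> by (simp add: convex_cc_def)
    qed
  qed
  then have "interval_cc G (\<Inter>?F) = \<Inter>?F"
    unfolding interval_cc_def by blast
  moreover have "\<Inter>?F \<subseteq> verts G"
    using V by blast
  ultimately show ?thesis
    by (simp add: hull_cc_def hull_def convex_cc_def)
qed

definition hull_set_cc :: "'a ugraph \<Rightarrow> 'a set \<Rightarrow> bool" where
  "hull_set_cc G S \<longleftrightarrow> S \<subseteq> verts G \<and> hull_cc G S = verts G"

definition hn_cc :: "'a ugraph \<Rightarrow> nat" where
  "hn_cc G = Min (card ` {S. hull_set_cc G S})"


section \<open>Random access machines\<close>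

text \<open>A unit-cost random access machine over natural numbers, presented as a structured
  language: finitely many named registers (those the program mentions) and one memory with
  indirect addressing. The arithmetic is addition and truncated subtraction, and conditions
  compare two expressions. Time counts every command executed and every node of every
  expression evaluated. A computation that evaluates anything to a value above the word bound
  \<open>w\<close> (in particular, that uses an address above it) has no execution.\<close>

datatype expr = Num nat | Reg string | Mem expr | Plus expr expr | Minus expr expr

datatype com =
    Skip
  | Assign string expr
  | Write expr expr
  | Seq com com
  | IfLess expr expr com com
  | WhileLess expr expr com

type_synonym state = "(string \<Rightarrow> nat) \<times> (nat \<Rightarrow> nat)"

fun val :: "state \<Rightarrow> expr \<Rightarrow> nat" where
  "val s (Num k) = k"
| "val s (Reg x) = fst s x"
| "val s (Mem a) = snd s (val s a)"
| "val s (Plus a b) = val s a + val s b"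
| "val s (Minus a b) = val s a - val s b"

fun fits :: "nat \<Rightarrow> state \<Rightarrow> expr \<Rightarrow> bool" where
  "fits w s (Num k) \<longleftrightarrow> k \<le> w"
| "fits w s (Reg x) \<longleftrightarrow> fst s x \<le> w"
| "fits w s (Mem a) \<longleftrightarrow> fits w s a \<and> snd s (val s a) \<le> w"
| "fits w s (Plus a b) \<longleftrightarrow> fits w s a \<and> fits w s b \<and> val s a + val s b \<le> w"
| "fits w s (Minus a b) \<longleftrightarrow> fits w s a \<and> fits w s b"

fun cost :: "expr \<Rightarrow> nat" where
  "cost (Num k) = 1"
| "cost (Reg x) = 1"
| "cost (Mem a) = 1 + cost a"
| "cost (Plus a b) = 1 + cost a + cost b"
| "cost (Minus a b) = 1 + cost a + cost b"

text \<open>\<open>exec w c s t s'\<close>: started in \<open>s\<close> under word bound \<open>w\<close>, the program \<open>c\<close> halts in \<open>s'\<close>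
  after exactly \<open>t\<close> time units.\<close>

inductive exec :: "nat \<Rightarrow> com \<Rightarrow> state \<Rightarrow> nat \<Rightarrow> state \<Rightarrow> bool" for w where
  Skip: "exec w Skip s 1 s"
| Assign: "fits w s e \<Longrightarrow>
    exec w (Assign x e) s (1 + cost e) ((fst s)(x := val s e), snd s)"
| Write: "fits w s a \<Longrightarrow> fits w s e \<Longrightarrow>
    exec w (Write a e) s (1 + cost a + cost e) (fst s, (snd s)(val s a := val s e))"
| Seq: "exec w c1 s t1 s1 \<Longrightarrow> exec w c2 s1 t2 s2 \<Longrightarrow>
    exec w (Seq c1 c2) s (t1 + t2) s2"
| IfTrue: "fits w s a \<Longrightarrow> fits w s b \<Longrightarrow> val s a < val s b \<Longrightarrow> exec w c1 s t s1 \<Longrightarrow>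
    exec w (IfLess a b c1 c2) s (1 + cost a + cost b + t) s1"
| IfFalse: "fits w s a \<Longrightarrow> fits w s b \<Longrightarrow> \<not> val s a < val s b \<Longrightarrow> exec w c2 s t s1 \<Longrightarrow>
    exec w (IfLess a b c1 c2) s (1 + cost a + cost b + t) s1"
| WhileFalse: "fits w s a \<Longrightarrow> fits w s b \<Longrightarrow> \<not> val s a < val s b \<Longrightarrow>
    exec w (WhileLess a b c) s (1 + cost a + cost b) s"
| WhileTrue: "fits w s a \<Longrightarrow> fits w s b \<Longrightarrow> val s a < val s b \<Longrightarrow> exec w c s t1 s1 \<Longrightarrow>
    exec w (WhileLess a b c) s1 t2 s2 \<Longrightarrow>
    exec w (WhileLess a b c) s (1 + cost a + cost b + t1 + t2) s2"

lemma exec_deterministic: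
  assumes "exec w c s t s'" and "exec w c s u s''"
  shows "u = t \<and> s'' = s'"
  using assms
proof (induction arbitrary: u s'' rule: exec.induct)
  case (Seq c1 s t1 s1 c2 t2 s2)
  note IH = Seq.IH
  from Seq.prems show ?case
  proof (cases rule: exec.cases)
    case (Seq u1 r1 u2)
    with IH(1)[OF Seq(2)] IH(2)[of u2 s''] show ?thesis by simp
  qed
next
  case (WhileTrue s a b c t1 s1 t2 s2)
  note IH = WhileTrue.IH and less = WhileTrue.hyps(3)
  from WhileTrue.prems show ?case
  proof (cases rule: exec.cases)
    case WhileFalse
    with less show ?thesis by simp
  next
    case (WhileTrue u1 r1 u2)
    with IH(1)[of u1 r1] IH(2)[of u2 s''] show ?thesis by simp
  qed
next
  case (IfTrue s a b c1 t s1 c2)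
  note IH = IfTrue.IH and less = IfTrue.hyps(3)
  from IfTrue.prems show ?case
  proof (cases rule: exec.cases)
    case (IfTrue u1)
    with IH[of u1 s''] show ?thesis by simp
  next
    case IfFalse
    with less show ?thesis by simp
  qed
next
  case (IfFalse s a b c2 t s1 c1)
  note IH = IfFalse.IH and less = IfFalse.hyps(3)
  from IfFalse.prems show ?case
  proof (cases rule: exec.cases)
    case IfTrue
    with less show ?thesis by simp
  next
    case (IfFalse u1)
    with IH[of u1 s''] show ?thesis by simp
  qed
qed (erule exec.cases; simp)+


section \<open>Graph parameters computable in linear time\<close>

text \<open>The vertices of \<open>G\<close> are numbered \<open>0, \<dots>, n - 1\<close> in an arbitrary order. The input
  consists of \<open>n\<close> followed by one block per vertex, in the order of the numbering: its degree
  and then its neighbours, in arbitrary order.\<close>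

definition adjacency_lists :: "'a ugraph \<Rightarrow> nat list \<Rightarrow> bool" where
  "adjacency_lists G xs \<longleftrightarrow> (\<exists>vs ls. distinct vs \<and> set vs = verts G \<and> length ls = length vs \<and>
     (\<forall>i<length vs. distinct (ls ! i) \<and>
        set (ls ! i) = {j. j < length vs \<and> adjacent G (vs ! i) (vs ! j)}) \<and>
     xs = length vs # concat (map (\<lambda>l. length l # l) ls))"

definition init_state :: "nat list \<Rightarrow> state" where
  "init_state xs = ((\<lambda>_. 0), (\<lambda>i. if i < length xs then xs ! i else 0))"

definition graph_size :: "'a ugraph \<Rightarrow> nat" where
  "graph_size G = card (verts G) + card (edges G)"

text \<open>One program must work for all graphs of the class \<open>K\<close> and all of their representations;
  nothing is required of it on other inputs. The result is left in the register \<open>out\<close>.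
  The word bound is polynomial in the size of the graph, i.e. words have logarithmic length;
  the offsets keep both bounds meaningful for graphs of size 0 and 1.\<close>

definition linear_time_computable_on :: "('a ugraph \<Rightarrow> bool) \<Rightarrow> ('a ugraph \<Rightarrow> nat) \<Rightarrow> bool" where
  "linear_time_computable_on K f \<longleftrightarrow> (\<exists>prog c d. \<forall>G xs.
     simple_graph G \<and> K G \<and> adjacency_lists G xs \<longrightarrow>
     (\<exists>t s. exec ((graph_size G + 2) ^ d) prog (init_state xs) t s \<and>
        t \<le> c * (graph_size G + 1) \<and> fst s ''out'' = f G))"

end

theory Submission
  imports Defs
begin

text \<open>A vertex enters a convex set as soon as two of its neighbours lie in one connected component
  of the subgraph induced by the set. Relative to an induced path on four vertices, every other
  vertex of a \<open>P\<^sub>4\<close>-sparse graph is adjacent to none of it, to its two inner vertices, or to all of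
  it. Hence, in a connected component \<open>K\<close> without a universal vertex, a connected set of at least
  three vertices to which no single vertex can be added misses only leaves of \<open>K\<close>. So \<open>K\<close> contributes
  \<open>l + 2\<close> to the hull number if it has \<open>l > 0\<close> leaves; otherwise it contributes 2 if it contains a
  triangle, and 3 if not. A component with a universal vertex \<open>u\<close> contributes one more than the
  number of components left after the removal of \<open>u\<close>.

  No graph search is needed to compute this: induced subgraphs of \<open>G\<close> have components of diameter
  at most three, so three rounds of taking the maximum over closed neighbourhoods label the
  components. A component with neither universal vertices nor leaves contains a triangle if and
  only if it has an edge whose two ends agree on being adjacent to an arbitrarily chosen vertex.\<close>

section \<open>Connectivity and cycle convexity\<close>

text \<open>Every lower bound rests on one fact: for a hull set \<open>S\<close> and a component
  \<open>K\<close>, each proper subset of \<open>K\<close> containing the part of \<open>S\<close>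
  in \<open>K\<close> admits an entering vertex. A good choice of the subset shows what
  \<open>S\<close> must contain. The shape of the second half comes from the machine: it has no
  recursion and no multiplication, and each loop needs a hand-made invariant. So the hull number is
  rewritten as a sum of vertex weights that depend only on a vertex, its neighbours and data
  attached to its component; each phase after a short setup is then made of instances of one
  verified loop. The label of a component is the largest vertex number in it, hence names a vertex.
  That vertex serves as representative, its number as array index for data of the component, and it
  is the arbitrarily chosen vertex of the triangle test. Numbers start at 1, which frees 0 to mean
  an absent vertex. Word lengths are treated uniformly: stored values are linear in the size of the
  graph, expressions have bounded cost, and a power with base at least 2 absorbs all
  constants.\<close>

definition conn :: "'a ugraph \<Rightarrow> 'a set \<Rightarrow> 'a \<Rightarrow> 'a \<Rightarrow> bool" where
  "conn G S = (\<lambda>x y. x \<in> S \<and> y \<in> S \<and> adjacent G x y)\<^sup>*\<^sup>*"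

lemma conn_refl [simp]: "conn G S x x"
  by (simp add: conn_def)

lemma conn_trans: "conn G S x y \<Longrightarrow> conn G S y z \<Longrightarrow> conn G S x z"
  unfolding conn_def by (rule rtranclp_trans)

lemma conn_edge: "x \<in> S \<Longrightarrow> y \<in> S \<Longrightarrow> adjacent G x y \<Longrightarrow> conn G S x y"
  unfolding conn_def by blast

lemma conn_mono: "conn G S x y \<Longrightarrow> S \<subseteq> T \<Longrightarrow> conn G T x y"
  unfolding conn_def by (rule rtranclp_mono[THEN predicate2D, rotated]) auto

lemma conn_mem: "conn G S x y \<Longrightarrow> x \<in> S \<Longrightarrow> y \<in> S"
  unfolding conn_def by (induction rule: rtranclp_induct) auto

lemma conn_induct [consumes 1, case_names refl step]:
  assumes "conn G S x y" and "P x"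
    and "\<And>y z. conn G S x y \<Longrightarrow> y \<in> S \<Longrightarrow> z \<in> S \<Longrightarrow> adjacent G y z \<Longrightarrow> P y \<Longrightarrow> P z"
  shows "P y"
  using assms(1) unfolding conn_def
  by (induction rule: rtranclp_induct) (auto intro: assms(2,3) simp: conn_def)

lemma adjacent_commute: "adjacent G x y \<longleftrightarrow> adjacent G y x"
  by (simp add: adjacent_def insert_commute)

lemma conn_sym: "conn G S x y \<Longrightarrow> conn G S y x"
proof (induction rule: conn_induct)
  case (step y z)
  then show ?case
    by (meson adjacent_commute conn_edge conn_trans)
qed simp

lemma conn_first:
  assumes "conn G S x y" "x \<noteq> y"
  obtains z where "z \<in> S" "adjacent G x z"
  using assms unfolding conn_def by (auto elim: converse_rtranclpE)

lemma conn_last: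
  assumes "conn G S x y" "x \<noteq> y"
  obtains z where "z \<in> S" "adjacent G y z"
  using conn_first[OF conn_sym[OF assms(1)]] assms(2) by metis

text \<open>A path from \<open>c\<close> to a vertex outside the closed neighbourhood of
  \<open>c\<close> must leave that neighbourhood, and the edge from \<open>d\<close> to
  \<open>e'\<close> is where it does. Induced paths are built from this below.\<close>

lemma conn_distance_two:
  assumes "conn G S c e" "e \<noteq> c" "\<not> adjacent G c e"
  obtains d e' where "d \<in> S" "e' \<in> S" "adjacent G c d" "adjacent G d e'"
    "\<not> adjacent G c e'" "e' \<noteq> c"
proof -
  have "e = c \<or> adjacent G c e \<or>
    (\<exists>d e'. d \<in> S \<and> e' \<in> S \<and> adjacent G c d \<and> adjacent G d e' \<and> \<not> adjacent G c e' \<and> e' \<noteq> c)"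
    using assms(1) by (induction rule: conn_induct) blast+
  then show thesis
    using assms that by blast
qed

lemma conn_path:
  assumes "conn G S a b" "a \<in> S"
  obtains xs where "xs \<noteq> []" "hd xs = a" "last xs = b" "distinct xs" "set xs \<subseteq> S"
    "successively (adjacent G) xs"
proof -
  have "\<exists>xs. xs \<noteq> [] \<and> hd xs = a \<and> last xs = b \<and> distinct xs \<and> set xs \<subseteq> S \<and>
    successively (adjacent G) xs"
    using assms(1)
  proof (induction rule: conn_induct)
    case refl
    show ?case
      using assms(2) by (intro exI[of _ "[a]"]) simp
  next
    case (step y z)
    then obtain xs where xs: "xs \<noteq> []" "hd xs = a" "last xs = y" "distinct xs" "set xs \<subseteq> S"
      "successively (adjacent G) xs"
      by blast
    show ?case
    proof (cases "z \<in> set xs")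
      case True
      then obtain us ws where us: "xs = (us @ [z]) @ ws"
        by (metis append.assoc append_Cons append_Nil split_list)
      then have "successively (adjacent G) (us @ [z])"
        using xs(6) by (simp only: successively_append_iff)
      moreover have "hd (us @ [z]) = a"
        using xs(2) us by (cases us) auto
      ultimately show ?thesis
        using xs us by (intro exI[of _ "us @ [z]"]) auto
    next
      case False
      with xs step show ?thesis
        by (intro exI[of _ "xs @ [z]"]) (auto simp: successively_append_iff)
    qed
  qed
  with that show thesis by blast
qed

lemma successively_conn:
  "successively (adjacent G) xs \<Longrightarrow> set xs \<subseteq> S \<Longrightarrow> xs \<noteq> [] \<Longrightarrow> conn G S (hd xs) (last xs)"
proof (induction xs)
  case (Cons x xs)
  show ?case
  proof (cases "xs = []")
    case False
    then have "adjacent G x (hd xs)" "successively (adjacent G) xs"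
      using Cons.prems(1) by (simp_all add: successively_Cons)
    with Cons False show ?thesis
      using conn_edge[of x S "hd xs" G] conn_trans[of G S x "hd xs" "last xs"] hd_in_set[OF False]
      by (metis Cons.IH Cons.prems(2) False \<open>adjacent G x (hd xs)\<close>
        \<open>successively (adjacent G) xs\<close> last.simps list.sel(1) list.set_intros(1)
        set_subset_Cons subset_code(1))
  qed simp
qed simp

section \<open>Vertices that can enter a convex set\<close>

locale sgraph =
  fixes G :: "'a ugraph"
  assumes simple: "simple_graph G"
begin

abbreviation adj :: "'a \<Rightarrow> 'a \<Rightarrow> bool" where
  "adj \<equiv> adjacent G"

abbreviation V :: "'a set" where
  "V \<equiv> verts G"

abbreviation nbrs :: "'a \<Rightarrow> 'a set" where
  "nbrs x \<equiv> {y. adj x y}"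

lemma adj_irrefl [simp]: "\<not> adj x x"
  using simple by (fastforce simp: simple_graph_def adjacent_def)

lemma adj_sym: "adj x y \<Longrightarrow> adj y x"
  by (simp add: adjacent_commute)

lemma adj_verts: "adj x y \<Longrightarrow> x \<in> V \<and> y \<in> V"
  using simple by (fastforce simp: simple_graph_def adjacent_def)

lemma finite_V [simp]: "finite V"
  using simple by (simp add: simple_graph_def)

lemma finite_nbrs [simp]: "finite (nbrs x)"
  by (rule finite_subset[OF _ finite_V]) (use adj_verts in blast)

text \<open>A path inside \<open>T\<close> from \<open>a\<close> to \<open>b\<close>, closed up
  through \<open>v\<close>, is a cycle that leaves \<open>T\<close> only in \<open>v\<close>; since
  \<open>a\<close> and \<open>b\<close> differ, it has at least three vertices.\<close>

lemma convex_closed: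
  assumes T: "convex_cc G T" and v: "adj v a" "adj v b" and ab: "a \<noteq> b" "a \<in> T" "conn G T a b"
  shows "v \<in> T"
proof (rule ccontr)
  assume vT: "v \<notin> T"
  obtain xs where xs: "xs \<noteq> []" "hd xs = a" "last xs = b" "distinct xs" "set xs \<subseteq> T"
    "successively (adjacent G) xs"
    using conn_path[OF ab(3,2)] by blast
  have len: "2 \<le> length xs"
    using xs(1-3) ab(1) by (cases xs; cases "tl xs") auto
  have "adj ((v # xs) ! i) ((v # xs) ! (Suc i mod length (v # xs)))"
    if i: "i < length (v # xs)" for i
  proof -
    consider "i = 0" | "i = length xs" | j where "i = Suc j" "Suc j < length xs"
      using i by (cases i) (auto, metis Suc_lessI)
    then show ?thesis
    proof cases
      case 1
      with len xs(1,2) v(1) show ?thesis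
        by (auto simp: hd_conv_nth)
    next
      case 2
      with len xs(1,3) v(2) show ?thesis
        by (auto simp: last_conv_nth nth_Cons' adj_sym)
    next
      case 3
      with xs(6) show ?thesis
        by (auto simp: successively_conv_nth)
    qed
  qed
  moreover have "set xs \<subseteq> V"
    using T xs(5) by (auto simp: convex_cc_def)
  moreover have "v \<in> V"
    using v(1) adj_verts by blast
  moreover have "v \<notin> set xs"
    using xs(5) vT by blast
  ultimately have "is_cycle G (v # xs)"
    using len xs(4) by (auto simp: is_cycle_def)
  moreover have "set (v # xs) - T = {v}"
    using xs(5) vT by auto
  ultimately have "v \<in> interval_cc G T"
    using \<open>v \<in> V\<close> unfolding interval_cc_def by blast
  then show False
    using T vT by (simp add: convex_cc_def)
qed

text \<open>Deleting \<open>v\<close> from the cycle leaves a path inside \<open>T\<close> whose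
  ends are distinct neighbours of \<open>v\<close>. Together with \<open>convex_closed\<close> this
  replaces cycles by connectivity everywhere below.\<close>

lemma cycle_conn:
  assumes p: "is_cycle G p" and v: "set p - T = {v}"
  obtains a b where "a \<noteq> b" "a \<in> T" "b \<in> T" "adj v a" "adj v b" "conn G T a b"
proof -
  let ?n = "length p"
  obtain k where k: "k < ?n" "p ! k = v"
    using v by (metis DiffD1 in_set_conv_nth singletonI)
  \<comment> \<open>Rotating the cycle puts \<open>v\<close> first, so that the rest of it is the
    tail of a list.\<close>
  define q where "q = rotate k p"
  have n: "3 \<le> ?n" "length q = ?n" and dq: "distinct q" and sq: "set q = set p"
    using p by (simp_all add: is_cycle_def q_def)
  have nth: "q ! i = p ! ((k + i) mod ?n)" if "i < ?n" for i
    using that by (simp add: q_def nth_rotate)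
  have adjq: "adj (q ! i) (q ! (Suc i mod ?n))" if "i < ?n" for i
  proof -
    have "adj (p ! ((k + i) mod ?n)) (p ! (Suc ((k + i) mod ?n) mod ?n))"
    proof -
      have "(k + i) mod ?n < ?n"
        using k(1) by (intro mod_less_divisor) linarith
      then show ?thesis
        using p by (simp add: is_cycle_def)
    qed
    moreover have "Suc ((k + i) mod ?n) mod ?n = (k + (Suc i mod ?n)) mod ?n"
      by (metis add_Suc_right mod_Suc_eq mod_add_right_eq)
    moreover have "Suc i mod ?n < ?n"
      using k(1) by (intro mod_less_divisor) linarith
    then have "q ! (Suc i mod ?n) = p ! ((k + (Suc i mod ?n)) mod ?n)"
      by (rule nth)
    ultimately show ?thesis
      unfolding nth[OF that] by (simp only:)
  qed
  obtain r where r: "q = v # r"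
    using k nth[of 0] n by (cases q; cases p) auto
  have lr: "Suc (length r) = ?n" and "v \<notin> set r"
    using r n dq by auto
  then have rT: "set r \<subseteq> T"
    using v sq r by auto
  have rne: "r \<noteq> []" "2 \<le> length r" "p \<noteq> []"
    using lr n by auto
  have "successively adj r"
    unfolding successively_conv_nth
  proof (intro allI impI)
    fix i assume "Suc i < length r"
    then show "adj (r ! i) (r ! Suc i)"
      using adjq[of "Suc i"] lr r by auto
  qed
  then have "conn G T (hd r) (last r)"
    using rT rne by (intro successively_conn)
  moreover have "adj v (hd r)"
    using adjq[of 0] lr r rne by (auto simp: hd_conv_nth)
  moreover have "adj v (last r)"
    using adjq[of "length r"] lr r rne by (auto simp: last_conv_nth nth_Cons' adj_sym)
  moreover have "hd r \<noteq> last r"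
    using dq r rne by (cases r; cases "tl r") auto
  ultimately show thesis
    using that rT rne by (meson hd_in_set last_in_set subsetD)
qed

section \<open>Reduction to connected components\<close>

lemma hull_set_cc_iff:
  "hull_set_cc G S \<longleftrightarrow> S \<subseteq> V \<and> (\<forall>T. convex_cc G T \<and> S \<subseteq> T \<longrightarrow> T = V)"
proof
  assume S: "hull_set_cc G S"
  have "T = V" if "convex_cc G T" "S \<subseteq> T" for T
  proof -
    have "hull_cc G S \<subseteq> T"
      unfolding hull_cc_def using that by (intro hull_minimal)
    with S that show ?thesis
      by (auto simp: hull_set_cc_def convex_cc_def)
  qed
  with S show "S \<subseteq> V \<and> (\<forall>T. convex_cc G T \<and> S \<subseteq> T \<longrightarrow> T = V)"
    by (simp add: hull_set_cc_def)
next
  assume S: "S \<subseteq> V \<and> (\<forall>T. convex_cc G T \<and> S \<subseteq> T \<longrightarrow> T = V)"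
  then have "hull_cc G S = V"
    using convex_cc_hull_cc[of S G] by (simp add: hull_cc_def hull_subset)
  with S show "hull_set_cc G S"
    by (simp add: hull_set_cc_def)
qed

definition component :: "'a set \<Rightarrow> bool" where
  "component K \<longleftrightarrow> K \<subseteq> V \<and> K \<noteq> {} \<and> (\<forall>x\<in>K. \<forall>y. y \<in> K \<longleftrightarrow> conn G V x y)"

lemma component_adj: "component K \<Longrightarrow> x \<in> K \<Longrightarrow> adj x y \<Longrightarrow> y \<in> K"
  unfolding component_def by (meson adj_verts conn_edge)

lemma component_conn:
  assumes K: "component K" and xy: "conn G S x y" "x \<in> K"
  shows "y \<in> K \<and> conn G (S \<inter> K) x y"
  using xy
proof (induction rule: conn_induct)
  case (step y z)
  then show ?case
    using component_adj[OF K] by (meson IntI conn_edge conn_trans)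
qed simp

text \<open>The rest of the graph is granted for free: \<open>T\<close> together with all vertices
  outside \<open>K\<close> contains \<open>S\<close> and is not all of \<open>V\<close>, so it is
  not convex. The vertex that enters lies in \<open>K\<close>, and no path leaves \<open>K\<close>.
  All lower bounds below use this.\<close>

lemma not_convex_in_component:
  assumes K: "component K" and S: "hull_set_cc G S" and T: "S \<inter> K \<subseteq> T" "T \<subseteq> K" "T \<noteq> K"
  obtains v a b where "v \<in> K - T" "a \<noteq> b" "a \<in> T" "b \<in> T" "adj v a" "adj v b" "conn G T a b"
proof -
  let ?T = "T \<union> (V - K)"
  have KV: "K \<subseteq> V"
    using K by (simp add: component_def)
  have TV: "S \<subseteq> ?T" "?T \<noteq> V" "?T \<subseteq> V"
    using T S KV by (auto simp: hull_set_cc_def)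
  then have "\<not> convex_cc G ?T"
    using S unfolding hull_set_cc_iff by blast
  then have "interval_cc G ?T \<noteq> ?T"
    using TV(3) by (simp add: convex_cc_def)
  then obtain v p where v: "v \<in> V" "v \<notin> ?T" and p: "is_cycle G p" "set p - ?T = {v}"
    unfolding interval_cc_def by blast
  then obtain a b where ab: "a \<noteq> b" "a \<in> ?T" "b \<in> ?T" "adj v a" "adj v b" "conn G ?T a b"
    using cycle_conn by metis
  have vK: "v \<in> K"
    using v by blast
  then have "a \<in> K" "b \<in> K"
    using ab component_adj[OF K] by blast+
  moreover have "conn G (?T \<inter> K) a b"
    using component_conn[OF K ab(6) \<open>a \<in> K\<close>] by blast
  moreover have "?T \<inter> K = T"
    using T by blast
  ultimately show thesis
    using that v vK ab by auto
qed

text \<open>Both halves refer to convex sets and hull sets of the whole graph and never to an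
  induced subgraph. So the values of disjoint pieces covering \<open>V\<close> simply add
  up.\<close>

definition hull_number_on :: "'a set \<Rightarrow> nat \<Rightarrow> bool" where
  "hull_number_on K m \<longleftrightarrow>
     (\<exists>S. S \<subseteq> K \<and> card S \<le> m \<and> (\<forall>T. convex_cc G T \<longrightarrow> S \<subseteq> T \<longrightarrow> K \<subseteq> T)) \<and>
     (\<forall>S. hull_set_cc G S \<longrightarrow> m \<le> card (S \<inter> K))"

lemma hn_cc_eq_sum:
  assumes fin: "finite I" and cover: "(\<Union>i\<in>I. K i) = V"
    and disj: "\<And>i j. i \<in> I \<Longrightarrow> j \<in> I \<Longrightarrow> i \<noteq> j \<Longrightarrow> K i \<inter> K j = {}"
    and h: "\<And>i. i \<in> I \<Longrightarrow> hull_number_on (K i) (h i)"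
  shows "hn_cc G = sum h I"
proof -
  let ?H = "{S. hull_set_cc G S}"
  have finK: "finite (K i)" if "i \<in> I" for i
    using that cover by (metis UN_upper finite_V finite_subset)
  have finH: "finite ?H"
    by (rule finite_subset[of _ "Pow V"]) (auto simp: hull_set_cc_def)
  have "\<exists>S. S \<subseteq> K i \<and> card S \<le> h i \<and> (\<forall>T. convex_cc G T \<longrightarrow> S \<subseteq> T \<longrightarrow> K i \<subseteq> T)"
    if "i \<in> I" for i
    using h[OF that] by (simp add: hull_number_on_def)
  then obtain S where S: "\<And>i. i \<in> I \<Longrightarrow> S i \<subseteq> K i" "\<And>i. i \<in> I \<Longrightarrow> card (S i) \<le> h i"
    "\<And>i T. i \<in> I \<Longrightarrow> convex_cc G T \<Longrightarrow> S i \<subseteq> T \<Longrightarrow> K i \<subseteq> T"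
    by metis
  have "hull_set_cc G (\<Union>i\<in>I. S i)"
    unfolding hull_set_cc_iff
  proof (intro conjI allI impI)
    show "(\<Union>i\<in>I. S i) \<subseteq> V"
      using S(1) cover by blast
    fix T assume T: "convex_cc G T \<and> (\<Union>i\<in>I. S i) \<subseteq> T"
    then have "K i \<subseteq> T" if "i \<in> I" for i
      using S(3)[of i T] that by blast
    then have "V \<subseteq> T"
      using cover by blast
    then show "T = V"
      using T by (auto simp: convex_cc_def)
  qed
  then have "hn_cc G \<le> card (\<Union>i\<in>I. S i)"
    unfolding hn_cc_def using finH by (intro Min_le) auto
  also have "\<dots> \<le> (\<Sum>i\<in>I. card (S i))"
    by (rule card_UN_le[OF fin])
  also have "\<dots> \<le> sum h I"
    by (rule sum_mono) (rule S(2))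
  finally have "hn_cc G \<le> sum h I" .
  moreover have "sum h I \<le> card U" if U: "hull_set_cc G U" for U
  proof -
    have "sum h I \<le> (\<Sum>i\<in>I. card (U \<inter> K i))"
      using h U by (intro sum_mono) (simp add: hull_number_on_def)
    also have "\<dots> = card (\<Union>i\<in>I. U \<inter> K i)"
      using fin finK disj by (subst card_UN_disjoint) auto
    also have "(\<Union>i\<in>I. U \<inter> K i) = U"
      using U cover by (auto simp: hull_set_cc_def)
    finally show ?thesis .
  qed
  then have "sum h I \<le> hn_cc G"
    unfolding hn_cc_def using finH \<open>hull_set_cc G (\<Union>i\<in>I. S i)\<close>
    by (intro Min.boundedI) auto
  ultimately show ?thesis by simp
qed

section \<open>Components with a universal vertex\<close>

definition universal_in :: "'a set \<Rightarrow> 'a \<Rightarrow> bool" where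
  "universal_in K u \<longleftrightarrow> u \<in> K \<and> (\<forall>v\<in>K. v \<noteq> u \<longrightarrow> adj u v)"

text \<open>\<open>D\<close> and \<open>f\<close> present the components of \<open>K - {u}\<close>:
  \<open>f\<close> sends a vertex to the representative of its component. Every edge avoiding
  \<open>u\<close> spans a triangle with \<open>u\<close>, so from \<open>u\<close> and one vertex
  of a component the closure spreads over that component.\<close>

lemma hull_number_on_universal:
  assumes K: "component K" and u: "universal_in K u" and D: "D \<subseteq> K - {u}"
    and f: "\<And>x. x \<in> K - {u} \<Longrightarrow> f x \<in> D \<and> conn G (K - {u}) (f x) x"
    and f_cong: "\<And>x y. x \<in> K - {u} \<Longrightarrow> conn G (K - {u}) x y \<Longrightarrow> f x = f y"
    and f_id: "\<And>d. d \<in> D \<Longrightarrow> f d = d"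
  shows "hull_number_on K (1 + card D)"
proof -
  have finK: "finite K"
    using K by (auto simp: component_def intro: finite_subset)
  then have finD: "finite D"
    using D by (meson finite_Diff finite_subset)
  have uK: "u \<in> K" and adju: "\<And>v. v \<in> K \<Longrightarrow> v \<noteq> u \<Longrightarrow> adj u v"
    using u by (auto simp: universal_in_def)
  have "K \<subseteq> T" if T: "convex_cc G T" "insert u D \<subseteq> T" for T
  proof
    fix x assume x: "x \<in> K"
    show "x \<in> T"
    proof (cases "x = u")
      case False
      then have "f x \<in> D" and c: "conn G (K - {u}) (f x) x"
        using f x by auto
      from c show ?thesis
      proof (induction rule: conn_induct)
        case refl
        then show ?case
          using \<open>f x \<in> D\<close> T by blast
      next
        case (step y z)
        then have "adj u y" "adj u z"
          using adju by auto
        then show ?case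
          using step T by (intro convex_closed[OF T(1), of z u y]) (auto intro: conn_edge adj_sym)
      qed
    qed (use T in blast)
  qed
  moreover have "insert u D \<subseteq> K" "card (insert u D) \<le> 1 + card D"
    using uK D finD by (auto simp: card_insert_if)
  moreover have "1 + card D \<le> card (S \<inter> K)" if S: "hull_set_cc G S" for S
  proof -
    let ?S = "S \<inter> K - {u}"
    have fin: "finite ?S"
      using finK by blast
    have surj: "D \<subseteq> f ` ?S"
    proof
      fix d assume d: "d \<in> D"
      show "d \<in> f ` ?S"
      proof (rule ccontr)
        assume nd: "d \<notin> f ` ?S"
        \<comment> \<open>All of \<open>K\<close> except the component represented by
          \<open>d\<close>. The vertices of that component see nothing but \<open>u\<close> in
          \<open>?T\<close>, so none of them can enter.\<close>
        let ?T = "{x \<in> K. x = u \<or> f x \<noteq> d}"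
        have "d \<in> K - ?T"
          using d D f_id by auto
        then have "?T \<noteq> K" by blast
        moreover have "S \<inter> K \<subseteq> ?T" "?T \<subseteq> K"
          using nd by auto
        ultimately obtain v a b where v: "v \<in> K - ?T" "a \<noteq> b" "a \<in> ?T" "b \<in> ?T"
          "adj v a" "adj v b" "conn G ?T a b"
          using not_convex_in_component[OF K S, of ?T thesis] by simp
        have "c = u" if c: "c \<in> ?T" "adj v c" for c
        proof (rule ccontr)
          assume "c \<noteq> u"
          then have "conn G (K - {u}) v c"
            using c v(1) by (intro conn_edge) auto
          then have "f v = f c"
            using v(1) by (intro f_cong) auto
          then show False
            using c v(1) \<open>c \<noteq> u\<close> by auto
        qed
        then show False
          using v by blast
      qed
    qed
    then have le: "card D \<le> card ?S"
      using fin by (meson card_image_le card_mono finite_imageI le_trans)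
    show ?thesis
    proof (cases "u \<in> S")
      case True
      then have "S \<inter> K = insert u ?S"
        using uK by blast
      then have "card (S \<inter> K) = Suc (card ?S)"
        using fin by (metis card_insert_disjoint Diff_iff singletonI)
      then show ?thesis
        using le by simp
    next
      \<comment> \<open>Without \<open>u\<close>, the first vertex to enter needs two vertices of
        \<open>S\<close> connected inside \<open>S\<close>, hence in one component of
        \<open>K - {u}\<close>. They have the same image under \<open>f\<close>, so \<open>S\<close>
        has a vertex more than \<open>D\<close>.\<close>
      case False
      then have eq: "?S = S \<inter> K"
        by blast
      have "S \<inter> K \<noteq> K"
        using False uK by blast
      then obtain v a b where v: "a \<noteq> b" "a \<in> S \<inter> K" "b \<in> S \<inter> K" "conn G (S \<inter> K) a b"
        using not_convex_in_component[OF K S, of "S \<inter> K" thesis] by simp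
      then have "conn G (K - {u}) a b"
        using eq by (intro conn_mono[OF v(4)]) auto
      then have "f a = f b"
        using v eq by (intro f_cong) auto
      then have "\<not> inj_on f ?S"
        using v eq by (auto simp: inj_on_def)
      then have "card (f ` ?S) < card ?S"
        using fin by (meson card_image_le eq_card_imp_inj_on le_neq_implies_less)
      then have "card D < card ?S"
        using surj fin by (meson card_mono finite_imageI le_less_trans)
      then show ?thesis
        using eq by simp
    qed
  qed
  ultimately show ?thesis
    unfolding hull_number_on_def by blast
qed

definition leaves :: "'a set \<Rightarrow> 'a set" where
  "leaves K = {x \<in> K. card (nbrs x) = 1}"

lemma leaf_unique: "x \<in> leaves K \<Longrightarrow> adj x y \<Longrightarrow> adj x z \<Longrightarrow> y = z"
proof -
  assume x: "x \<in> leaves K" "adj x y" "adj x z"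
  then obtain w where "nbrs x = {w}"
    unfolding leaves_def using card_1_singletonE by blast
  with x(2,3) show "y = z"
    by (metis mem_Collect_eq singletonD)
qed

end

section \<open>\<open>P\<^sub>4\<close>-sparse graphs\<close>

locale p4_sparse_graph = sgraph +
  assumes p4_sparse: "P4_sparse G"
begin

definition p4 :: "'a \<Rightarrow> 'a \<Rightarrow> 'a \<Rightarrow> 'a \<Rightarrow> bool" where
  "p4 a b c d \<longleftrightarrow> adj a b \<and> adj b c \<and> adj c d \<and> \<not> adj a c \<and> \<not> adj a d \<and> \<not> adj b d"

lemma p4_distinct: "p4 a b c d \<Longrightarrow> distinct [a, b, c, d]"
  unfolding p4_def by (auto simp: adjacent_commute)

lemma p4_induces: "p4 a b c d \<Longrightarrow> induces_P4 G {a, b, c, d}"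
  unfolding induces_P4_def using p4_distinct[of a b c d]
  by (intro exI[of _ a] exI[of _ b] exI[of _ c] exI[of _ d]) (auto simp: p4_def dest: adj_verts)

lemma p4_unique:
  assumes P: "p4 a b c d" and Q: "p4 a' b' c' d'" and x: "x \<in> V" "x \<notin> {a, b, c, d}"
    and sub: "{a', b', c', d'} \<subseteq> {a, b, c, d, x}"
  shows "x \<notin> {a', b', c', d'}"
proof
  assume x': "x \<in> {a', b', c', d'}"
  let ?U = "{a, b, c, d, x}"
  let ?W = "{W. W \<subseteq> ?U \<and> induces_P4 G W}"
  have U: "?U \<subseteq> V" "card ?U = 5"
    using P x p4_distinct[OF P] by (auto simp: p4_def dest: adj_verts)
  have "finite ?W"
    by (rule finite_subset[of _ "Pow ?U"]) auto
  have "{a, b, c, d} \<in> ?W" "{a', b', c', d'} \<in> ?W"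
    using p4_induces[OF P] p4_induces[OF Q] sub by auto
  then have sub2: "{{a, b, c, d}, {a', b', c', d'}} \<subseteq> ?W"
    by blast
  have "{a, b, c, d} \<noteq> {a', b', c', d'}"
    using x(2) x' by blast
  then have "2 = card {{a, b, c, d}, {a', b', c', d'}}"
    by simp
  also have "\<dots> \<le> card ?W"
    by (rule card_mono[OF \<open>finite ?W\<close> sub2])
  finally show False
    using p4_sparse U unfolding P4_sparse_def by (meson not_less numeral_2_eq_2 lessI le_less_trans
      less_le_trans one_less_numeral_iff semiring_norm(76))
qed

text \<open>Each of the thirteen other adjacency patterns produces an induced path through
  \<open>x\<close> and three of \<open>a\<close>, \<open>b\<close>, \<open>c\<close>,
  \<open>d\<close>, which \<open>p4_unique\<close> forbids.\<close>

lemma p4_neighbour_type: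
  assumes P: "p4 a b c d" and x: "x \<in> V" "x \<notin> {a, b, c, d}"
  shows "(\<not> adj x a \<and> \<not> adj x b \<and> \<not> adj x c \<and> \<not> adj x d) \<or>
    (\<not> adj x a \<and> adj x b \<and> adj x c \<and> \<not> adj x d) \<or>
    (adj x a \<and> adj x b \<and> adj x c \<and> adj x d)"
proof (rule ccontr)
  assume n: "\<not> ?thesis"
  have np: "\<not> p4 e f g h" if "x \<in> {e, f, g, h}" "{e, f, g, h} \<subseteq> {a, b, c, d, x}" for e f g h
    using p4_unique[OF P _ x] that by blast
  have 1: "\<not> p4 x b c d" "\<not> p4 x c b a" "\<not> p4 x a b c" "\<not> p4 x d c b"
    "\<not> p4 a x c d" "\<not> p4 a b x d" "\<not> p4 c d x a" "\<not> p4 b a x d"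
    "\<not> p4 a x d c" "\<not> p4 d x a b"
    by (rule np; simp)+
  have "adj b a" "adj c b" "adj d c" "\<not> adj c a" "\<not> adj d a" "\<not> adj d b"
    "adj a b" "adj b c" "adj c d" "\<not> adj a c" "\<not> adj a d" "\<not> adj b d"
    using P by (auto simp: p4_def adjacent_commute)
  moreover have "adj a x = adj x a" "adj b x = adj x b" "adj c x = adj x c" "adj d x = adj x d"
    by (auto simp: adjacent_commute)
  ultimately show False
    using n 1 unfolding p4_def by argo
qed

text \<open>If \<open>C\<close> is closed in the sense of \<open>one_nbr\<close>, an outside neighbour \<open>x\<close> of \<open>C\<close> extends
  to an induced path \<open>x, c, d, e\<close>, relative to which any further neighbour of \<open>x\<close> has a
  forbidden type.\<close>

lemma outside_component_leaf:
  assumes K: "component K" and nu: "\<And>u. \<not> universal_in K u"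
    and C: "C \<subseteq> K" and C_conn: "\<And>x y. x \<in> C \<Longrightarrow> y \<in> C \<Longrightarrow> conn G C x y"
    and C3: "3 \<le> card C"
    and one_nbr: "\<And>v a b. v \<notin> C \<Longrightarrow> a \<in> C \<Longrightarrow> b \<in> C \<Longrightarrow> adj v a \<Longrightarrow> adj v b \<Longrightarrow> a = b"
    and x: "x \<in> K - C"
  shows "card (nbrs x) = 1"
proof -
  have third: "\<exists>y\<in>C. y \<noteq> c \<and> y \<noteq> c'" for c c'
  proof (rule ccontr)
    assume "\<not> ?thesis"
    then have "C \<subseteq> {c, c'}"
      by blast
    then have "card C \<le> card {c, c'}"
      by (intro card_mono) auto
    also have "\<dots> \<le> 2"
      by (simp add: card_insert_if)
    finally show False
      using C3 by simp
  qed
  have key: "nbrs x = {c}" if P: "p4 x c d e" and cd: "c \<in> C" "d \<in> C" "x \<notin> C" for x c d e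
  proof -
    have "y = c" if y: "adj x y" for y
    proof (rule ccontr)
      assume "y \<noteq> c"
      have "adj x c" "\<not> adj x d" "\<not> adj x e" "c \<noteq> d"
        using P p4_distinct[OF P] by (auto simp: p4_def)
      then have "y \<notin> C"
        using one_nbr cd y \<open>y \<noteq> c\<close> by blast
      then have "y \<notin> {x, c, d, e}"
        using y cd \<open>\<not> adj x e\<close> \<open>y \<noteq> c\<close> by auto
      \<comment> \<open>A vertex adjacent to an end of the path, here \<open>x\<close>, can only be
        of the type adjacent to all of it.\<close>
      then have "adj y c" "adj y d"
        using p4_neighbour_type[OF P, of y] y adj_sym adj_verts by blast+
      then show False
        using one_nbr[OF \<open>y \<notin> C\<close>] cd \<open>c \<noteq> d\<close> by blast
    qed
    moreover have "adj x c"
      using P by (simp add: p4_def)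
    ultimately show ?thesis by blast
  qed
  have attached: "nbrs x = {c}" if x: "x \<notin> C" and c: "c \<in> C" and xc: "adj x c" for x c
  proof (cases "\<exists>e\<in>C. e \<noteq> c \<and> \<not> adj c e")
    case True
    then obtain e where "e \<in> C" "e \<noteq> c" "\<not> adj c e" by blast
    then obtain d e' where "d \<in> C" "e' \<in> C" "adj c d" "adj d e'" "\<not> adj c e'" "e' \<noteq> c"
      using conn_distance_two[OF C_conn[OF c]] by metis
    moreover from this have "\<not> adj x d" "\<not> adj x e'"
      using one_nbr[OF x c _ xc] by (metis adj_irrefl)+
    ultimately show ?thesis
      using key[of x c d e'] c x xc by (simp add: p4_def)
  next
    case False
    then have cC: "adj c e" if "e \<in> C" "e \<noteq> c" for e
      using that by blast
    \<comment> \<open>Now \<open>C\<close> lies in the closed neighbourhood of \<open>c\<close>, so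
      the induced path must use a second outside vertex, attached elsewhere than at
      \<open>c\<close>. If none existed, a vertex \<open>y\<close> at distance two from
      \<open>c\<close>, reached through \<open>w\<close>, would give the induced path
      \<open>y\<close>, \<open>w\<close>, \<open>c\<close>, \<open>d\<close>, and another
      \<open>e\<close> in \<open>C\<close> would be adjacent to \<open>c\<close> but not to
      \<open>w\<close>.\<close>
    have "\<exists>x' c'. x' \<notin> C \<and> c' \<in> C \<and> c' \<noteq> c \<and> adj x' c'"
    proof (rule ccontr)
      assume "\<not> ?thesis"
      then have only_c: "c' = c" if "x' \<notin> C" "c' \<in> C" "adj x' c'" for x' c'
        using that by blast
      have "c \<in> K"
        using c C by blast
      then obtain z where z: "z \<in> K" "z \<noteq> c" "\<not> adj c z"
        using nu[of c] unfolding universal_in_def by blast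
      have "conn G V c z"
        using K z(1) \<open>c \<in> K\<close> unfolding component_def by blast
      then obtain w y where w: "adj c w" "adj w y" "\<not> adj c y" "y \<noteq> c"
        using conn_distance_two[OF _ z(2,3)] by metis
      have yC: "y \<notin> C"
        using cC w by blast
      have wC: "w \<notin> C"
        using only_c[OF yC, of w] w adj_sym by (metis adj_irrefl)
      obtain d where d: "d \<in> C" "d \<noteq> c"
        using third by blast
      obtain e where e: "e \<in> C" "e \<noteq> c" "e \<noteq> d"
        using third by blast
      have non: "\<not> adj y d" "\<not> adj w d" "\<not> adj y e" "\<not> adj w e"
        using only_c yC wC d e by blast+
      then have P: "p4 y w c d"
        using w cC[OF d] adj_sym unfolding p4_def by blast
      have "e \<notin> {y, w, c, d}" "e \<in> V" "adj e c"
        using e yC wC cC adj_verts adj_sym by blast+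
      then show False
        using p4_neighbour_type[OF P, of e] non adj_sym by blast
    qed
    then obtain x' c' where x': "x' \<notin> C" "c' \<in> C" "c' \<noteq> c" "adj x' c'"
      by blast
    have non: "\<not> adj x c'" "\<not> adj x' c"
      using one_nbr x x' c xc by blast+
    have cc': "adj c c'"
      using cC x' by blast
    \<comment> \<open>Otherwise any third vertex \<open>y\<close> of \<open>C\<close> gives the
      induced path \<open>x'\<close>, \<open>x\<close>, \<open>c\<close>, \<open>y\<close>, and
      \<open>c'\<close> is adjacent to its end \<open>x'\<close> but not to
      \<open>x\<close>.\<close>
    have "\<not> adj x x'"
    proof
      assume xx': "adj x x'"
      obtain y where y: "y \<in> C" "y \<noteq> c" "y \<noteq> c'"
        using third by blast
      have "\<not> adj x y" "\<not> adj x' y"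
        using one_nbr x x' c xc y by blast+
      then have P: "p4 x' x c y"
        using xx' xc non cC[OF y(1,2)] adj_sym unfolding p4_def by blast
      have "c' \<notin> {x', x, c, y}" "c' \<in> V"
        using x' x y adj_verts by blast+
      then show False
        using p4_neighbour_type[OF P, of c'] non x'(4) cc' adj_sym by blast
    qed
    then have "p4 x c c' x'"
      using xc cc' x'(4) non adj_sym unfolding p4_def by blast
    then show ?thesis
      using key c x' x by blast
  qed
  obtain c0 where c0: "c0 \<in> C"
    using third by blast
  then have "conn G V c0 x"
    using x C K unfolding component_def by blast
  \<comment> \<open>A walk leaving \<open>C\<close> must turn back after one edge, because an
    attached vertex has its only neighbour in \<open>C\<close>.\<close>
  then have "x \<in> C \<or> (\<exists>c\<in>C. nbrs x = {c})"
  proof (induction rule: conn_induct)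
    case refl
    then show ?case
      using c0 by blast
  next
    case (step y z)
    show ?case
    proof (cases "y \<in> C")
      case True
      then show ?thesis
        using attached[of z y] step adj_sym by blast
    next
      case False
      then obtain c where "c \<in> C" "nbrs y = {c}"
        using step by blast
      then have "z = c"
        using step(4) by blast
      with \<open>c \<in> C\<close> show ?thesis by blast
    qed
  qed
  then show ?thesis
    using x by auto
qed

text \<open>The component of \<open>a\<close> in the subgraph induced by \<open>T\<close> satisfies
  the hypotheses of \<open>outside_component_leaf\<close>: convexity yields the one-neighbour
  condition, and \<open>a\<close>, \<open>b\<close>, \<open>c\<close> are three vertices. What it
  misses in \<open>K\<close> are leaves, and these lie in \<open>T\<close> by assumption.\<close>

lemma convex_contains_component:
  assumes K: "component K" and nu: "\<And>u. \<not> universal_in K u"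
    and T: "convex_cc G T" "leaves K \<subseteq> T"
    and abc: "a \<in> K" "a \<in> T" "b \<in> T" "c \<in> T" "adj a b" "adj b c" "a \<noteq> c"
  shows "K \<subseteq> T"
proof -
  let ?C = "{x. conn G T a x}"
  have CK: "?C \<subseteq> K"
    using component_conn[OF K _ abc(1)] by blast
  have CT: "?C \<subseteq> T"
    using conn_mem abc(2) by fast
  have step: "conn G T x y \<longrightarrow> conn G ?C x y" if "x \<in> ?C" for x y
  proof
    assume "conn G T x y"
    then have "y \<in> ?C \<and> conn G ?C x y"
    proof (induction rule: conn_induct)
      case refl
      with that show ?case by simp
    next
      case (step y z)
      then have "conn G T a z"
        using conn_trans conn_edge by (metis mem_Collect_eq)
      then show ?case
        using step conn_trans conn_edge by (metis mem_Collect_eq)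
    qed
    then show "conn G ?C x y" ..
  qed
  have C_conn: "conn G ?C x y" if "x \<in> ?C" "y \<in> ?C" for x y
    using step[OF that(1), of y] that conn_sym conn_trans by (metis mem_Collect_eq)
  have b: "b \<in> ?C"
    using abc by (auto intro: conn_edge)
  then have c: "c \<in> ?C"
    using abc conn_trans conn_edge by (metis mem_Collect_eq)
  have "a \<noteq> b" "b \<noteq> c"
    using abc adj_irrefl by metis+
  then have "card {a, b, c} = 3"
    using abc(7) by simp
  moreover have "{a, b, c} \<subseteq> ?C"
    using b c by auto
  moreover have "finite ?C"
    using CK K finite_V unfolding component_def by (meson finite_subset)
  ultimately have C3: "3 \<le> card ?C"
    by (metis card_mono)
  have one_nbr: "p = q" if "v \<notin> ?C" "p \<in> ?C" "q \<in> ?C" "adj v p" "adj v q" for v p q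
  proof (rule ccontr)
    assume "p \<noteq> q"
    moreover have "conn G T p q"
      using that conn_sym conn_trans by (metis mem_Collect_eq)
    moreover have pT: "p \<in> T"
      using that CT by blast
    ultimately have "v \<in> T"
      using convex_closed[OF T(1) that(4,5)] by blast
    then have "conn G T a v"
      using that pT conn_edge[of p T v G] adj_sym conn_trans by (metis mem_Collect_eq)
    then show False
      using that by blast
  qed
  show ?thesis
  proof
    fix x assume "x \<in> K"
    show "x \<in> T"
    proof (cases "x \<in> ?C")
      case False
      then have x: "x \<in> K - ?C"
        using \<open>x \<in> K\<close> by blast
      have "card (nbrs x) = 1"
        by (rule outside_component_leaf[OF K nu CK _ C3 _ x]; fact C_conn one_nbr)
      then have "x \<in> leaves K"
        using \<open>x \<in> K\<close> by (simp add: leaves_def)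
      then show ?thesis
        using T by blast
    qed (use CT in blast)
  qed
qed

end

section \<open>Hull numbers of the connected components\<close>

context sgraph
begin

lemma component_finite: "component K \<Longrightarrow> finite K"
  unfolding component_def using finite_V finite_subset by blast

lemma component_distance_two:
  assumes K: "component K" and nu: "\<And>u. \<not> universal_in K u" and r: "r \<in> K"
  obtains d e where "d \<in> K" "e \<in> K" "adj r d" "adj d e" "\<not> adj r e" "e \<noteq> r"
proof -
  obtain z where z: "z \<in> K" "z \<noteq> r" "\<not> adj r z"
    using nu[of r] r unfolding universal_in_def by blast
  then have "conn G V r z"
    using K r unfolding component_def by blast
  then obtain d e where "adj r d" "adj d e" "\<not> adj r e" "e \<noteq> r"
    using conn_distance_two[OF _ z(2,3)] by metis
  moreover from this have "d \<in> K" "e \<in> K"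
    using component_adj[OF K] r by blast+
  ultimately show thesis
    using that by blast
qed

lemma card_hull_set_lower:
  assumes K: "component K" and S: "hull_set_cc G S" and m: "m < card K"
    and T: "\<And>T. T \<subseteq> K \<Longrightarrow> card T \<le> m \<Longrightarrow> S \<inter> K \<subseteq> T \<Longrightarrow>
      (\<And>v a b. v \<in> K - T \<Longrightarrow> a \<noteq> b \<Longrightarrow> a \<in> T \<Longrightarrow> b \<in> T \<Longrightarrow> adj v a \<Longrightarrow> adj v b \<Longrightarrow>
        \<not> conn G T a b)"
  shows "Suc m \<le> card (S \<inter> K)"
proof (rule ccontr)
  assume "\<not> ?thesis"
  then have le: "card (S \<inter> K) \<le> m"
    by simp
  then have "S \<inter> K \<noteq> K"
    using m by auto
  then obtain v a b where "v \<in> K - S \<inter> K" "a \<noteq> b" "a \<in> S \<inter> K" "b \<in> S \<inter> K" "adj v a" "adj v b"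
    "conn G (S \<inter> K) a b"
    using not_convex_in_component[OF K S, of "S \<inter> K" thesis] by simp
  then show False
    using T[of "S \<inter> K"] le by blast
qed

end

context p4_sparse_graph
begin

text \<open>A leaf has too few neighbours ever to enter, so hull sets contain all leaves. The two
  connected vertices of \<open>T\<close> through which some \<open>v\<close> enters have a neighbour
  in \<open>T\<close> besides \<open>v\<close>, so they are two further vertices that are not
  leaves.\<close>

lemma hull_number_on_leaves:
  assumes K: "component K" and nu: "\<And>u. \<not> universal_in K u" and L: "leaves K \<noteq> {}"
  shows "hull_number_on K (card (leaves K) + 2)"
proof -
  let ?L = "leaves K"
  have finK: "finite K"
    by (rule component_finite[OF K])
  have LK: "?L \<subseteq> K"
    by (auto simp: leaves_def)
  then have finL: "finite ?L"
    using finK finite_subset by blast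
  obtain x where x: "x \<in> ?L" "x \<in> K"
    using L LK by blast
  obtain c d where cd: "c \<in> K" "d \<in> K" "adj x c" "adj c d" "\<not> adj x d" "d \<noteq> x"
    using component_distance_two[OF K nu x(2)] by metis
  \<comment> \<open>Looking for distance two once more, now from \<open>c\<close>, finds a neighbour
    \<open>b\<close> of \<open>c\<close> that is not a leaf; \<open>x\<close>, \<open>c\<close>,
    \<open>b\<close> is then the path required by \<open>convex_contains_component\<close>.\<close>
  obtain b e where be: "adj c b" "adj b e" "\<not> adj c e" "e \<noteq> c"
    using component_distance_two[OF K nu cd(1)] by metis
  have b: "b \<in> K" "adj b c"
    using be cd component_adj[OF K] adj_sym by blast+
  have c: "c \<notin> ?L"
    using cd leaf_unique[of c K x d] adj_sym by blast
  have "b \<notin> ?L"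
    using be b leaf_unique[of b K c e] by blast
  have "c \<noteq> b"
    using be by auto
  let ?S = "?L \<union> {c, b}"
  have card_S: "card ?S = card ?L + 2"
    using finL c \<open>b \<notin> ?L\<close> \<open>c \<noteq> b\<close> by (subst card_Un_disjoint) auto
  have "?S \<subseteq> K"
    using LK cd b by blast
  moreover have "K \<subseteq> T" if "convex_cc G T" "?S \<subseteq> T" for T
    using convex_contains_component[OF K nu that(1), of x c b] that x cd be \<open>b \<notin> ?L\<close> by auto
  moreover have "card ?L + 2 \<le> card (S \<inter> K)" if S: "hull_set_cc G S" for S
  proof -
    have LS: "?L \<subseteq> S"
    proof
      fix y assume y: "y \<in> ?L"
      show "y \<in> S"
      proof (rule ccontr)
        assume "y \<notin> S"
        then have "S \<inter> K \<subseteq> K - {y}" "K - {y} \<noteq> K"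
          using y LK by blast+
        then obtain v p q where "v \<in> K - (K - {y})" "p \<noteq> q" "adj v p" "adj v q"
          using not_convex_in_component[OF K S, of "K - {y}" thesis] by auto
        then show False
          using leaf_unique[OF y] by blast
      qed
    qed
    have "card ?L + 2 \<le> card K"
      using card_mono[OF finK \<open>?S \<subseteq> K\<close>] card_S by simp
    then have "Suc (card ?L + 1) \<le> card (S \<inter> K)"
    proof (intro card_hull_set_lower[OF K S] notI)
      fix T v p q
      assume T: "T \<subseteq> K" "card T \<le> card ?L + 1" "S \<inter> K \<subseteq> T"
        and v: "v \<in> K - T" "p \<noteq> q" "p \<in> T" "q \<in> T" "adj v p" "adj v q" "conn G T p q"
      obtain p' where p': "p' \<in> T" "adj p p'"
        using conn_first[OF v(7,2)] by blast
      obtain q' where q': "q' \<in> T" "adj q q'"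
        using conn_last[OF v(7,2)] by blast
      have "p \<notin> ?L" "q \<notin> ?L"
        using leaf_unique p' q' v adj_sym by (metis DiffD2)+
      moreover have "?L \<subseteq> T"
        using LS LK T by blast
      ultimately have "?L \<union> {p, q} \<subseteq> T"
        using v by blast
      moreover have "card (?L \<union> {p, q}) = card ?L + 2"
        using finL \<open>p \<notin> ?L\<close> \<open>q \<notin> ?L\<close> v(2) by (subst card_Un_disjoint) auto
      ultimately show False
        using T finK card_mono[of T "?L \<union> {p, q}"] finite_subset[of T K] by simp
    qed simp
    then show ?thesis by simp
  qed
  ultimately show ?thesis
    unfolding hull_number_on_def using card_S by (metis order_refl)
qed

lemma hull_number_on_triangle:
  assumes K: "component K" and nu: "\<And>u. \<not> universal_in K u" and L: "leaves K = {}"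
    and abc: "a \<in> K" "adj a b" "adj b c" "adj a c"
  shows "hull_number_on K 2"
proof -
  have ne: "a \<noteq> b" "a \<noteq> c" "b \<noteq> c"
    using abc by auto
  have bc: "b \<in> K" "c \<in> K"
    using component_adj[OF K] abc by blast+
  have "K \<subseteq> T" if T: "convex_cc G T" "{a, b} \<subseteq> T" for T
  proof -
    have "c \<in> T"
      using T abc adj_sym by (intro convex_closed[OF T(1), of c a b]) (auto intro: conn_edge)
    then show ?thesis
      using convex_contains_component[OF K nu T(1), of a b c] T abc L ne by auto
  qed
  moreover have "{a, b} \<subseteq> K" "card {a, b} = 2"
    using abc bc ne by auto
  moreover have "Suc 1 \<le> card (S \<inter> K)" if S: "hull_set_cc G S" for S
  proof (rule card_hull_set_lower[OF K S])
    show "1 < card K"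
      using card_mono[OF component_finite[OF K], of "{a, b}"] abc bc ne by simp
    fix T v p q
    assume "T \<subseteq> K" "card T \<le> 1" "p \<noteq> q" "p \<in> T" "q \<in> T"
    then show "\<not> conn G T p q"
      using card_le_Suc0_iff_eq[of T] component_finite[OF K] finite_subset[of T K] by auto
  qed
  ultimately show ?thesis
    unfolding hull_number_on_def by (metis numeral_2_eq_2 One_nat_def order_refl)
qed

text \<open>Two vertices let a third one in only if they are adjacent, and then the three form a
  triangle.\<close>

lemma hull_number_on_triangle_free:
  assumes K: "component K" and nu: "\<And>u. \<not> universal_in K u" and L: "leaves K = {}"
    and tf: "\<forall>a\<in>K. \<forall>b c. adj a b \<longrightarrow> adj b c \<longrightarrow> \<not> adj a c"
  shows "hull_number_on K 3"
proof -
  obtain r where r: "r \<in> K"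
    using K unfolding component_def by blast
  obtain d e where de: "d \<in> K" "e \<in> K" "adj r d" "adj d e" "\<not> adj r e" "e \<noteq> r"
    using component_distance_two[OF K nu r] by metis
  have ne: "r \<noteq> d" "d \<noteq> e"
    using de by auto
  have "K \<subseteq> T" if T: "convex_cc G T" "{r, d, e} \<subseteq> T" for T
    using convex_contains_component[OF K nu T(1), of r d e] T de r L by auto
  moreover have rde: "{r, d, e} \<subseteq> K" "card {r, d, e} = 3"
    using de r ne by auto
  moreover have "3 \<le> card (S \<inter> K)" if S: "hull_set_cc G S" for S
  proof -
    have "Suc 2 \<le> card (S \<inter> K)"
    proof (rule card_hull_set_lower[OF K S], goal_cases)
      case 1
      then show ?case
        using card_mono[OF component_finite[OF K] rde(1)] rde(2) by simp
    next
      case (2 T v p q)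
      show ?case
      proof
        assume "conn G T p q"
        then obtain p' where p': "p' \<in> T" "adj p p'"
          using conn_first 2 by metis
        have "p' = q"
        proof (rule ccontr)
          assume "p' \<noteq> q"
          moreover have "p \<noteq> p'"
            using p' by auto
          ultimately have "card {p, q, p'} = 3"
            using 2 by auto
          moreover have "{p, q, p'} \<subseteq> T"
            using 2 p' by blast
          ultimately show False
            using 2 component_finite[OF K] card_mono[of T "{p, q, p'}"] finite_subset[of T K]
            by auto
        qed
        then show False
          using tf 2 p' by blast
      qed
    qed
    then show ?thesis by simp
  qed
  ultimately show ?thesis
    unfolding hull_number_on_def by (metis order_refl)
qed

text \<open>A further neighbour of the end of an induced path on four vertices would be adjacent to
  the whole path and close a triangle, so that end would be a leaf. Hence no such path starts in
  \<open>K\<close>, every vertex of \<open>K\<close> is within distance two of \<open>r\<close>, and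
  each edge joins a neighbour of \<open>r\<close> to a non-neighbour.\<close>

lemma triangle_free_bipartite:
  assumes K: "component K" and L: "leaves K = {}"
    and tf: "\<forall>a\<in>K. \<forall>b c. adj a b \<longrightarrow> adj b c \<longrightarrow> \<not> adj a c"
    and r: "r \<in> K" and y: "y \<in> K" "adj y z"
  shows "adj r y \<noteq> adj r z"
proof -
  have no_p4: "\<not> p4 a b c d" if a: "a \<in> K" for a b c d
  proof
    assume P: "p4 a b c d"
    have "y = b" if y: "adj a y" for y
    proof (rule ccontr)
      assume "y \<noteq> b"
      moreover have ab: "adj a b"
        using P by (simp add: p4_def)
      ultimately have "y \<notin> {a, b, c, d}" "y \<in> V"
        using P y adj_verts by (auto simp: p4_def)
      then have "adj y b"
        using p4_neighbour_type[OF P] y adj_sym by blast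
      then show False
        using tf a y ab by blast
    qed
    moreover have "adj a b"
      using P by (simp add: p4_def)
    ultimately have "nbrs a = {b}"
      by blast
    then have "a \<in> leaves K"
      using a by (simp add: leaves_def)
    then show False
      using L by blast
  qed
  have "conn G V r y"
    using K r y unfolding component_def by blast
  then have "y = r \<or> adj r y \<or> (\<exists>p. adj r p \<and> adj p y)"
  proof (induction rule: conn_induct)
    case (step u w)
    show ?case
    proof (rule ccontr)
      assume n: "\<not> ?case"
      then obtain p where "adj r p" "adj p u"
        using step by blast
      then have "p4 r p u w"
        using n step unfolding p4_def by blast
      then show False
        using no_p4 r by blast
    qed
  qed simp
  then consider "y = r" | "adj r y" | p where "adj r p" "adj p y" "y \<noteq> r" "\<not> adj r y"
    by blast
  then show ?thesis
  proof cases
    case 1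
    with y show ?thesis by simp
  next
    case 2
    with tf r y show ?thesis by blast
  next
    case 3
    have "adj r z"
    proof (rule ccontr)
      assume nz: "\<not> adj r z"
      have "p \<in> K"
        using component_adj[OF K r 3(1)] .
      then have "\<not> adj p z"
        using tf 3 y by blast
      then have "p4 r p y z"
        using 3 y nz unfolding p4_def by blast
      then show False
        using no_p4 r by blast
    qed
    with 3 show ?thesis by blast
  qed
qed

text \<open>One formula covers leaves, triangles and neither; the subtracted indicator is what the
  program computes as \<open>flag\<close>.\<close>

lemma hull_number_on_non_universal:
  assumes K: "component K" and nu: "\<And>u. \<not> universal_in K u" and r: "r \<in> K"
  shows "hull_number_on K (card (leaves K) +
    (3 - (if leaves K \<noteq> {} \<or> (\<exists>y\<in>K. \<exists>z. adj y z \<and> adj r y = adj r z) then 1 else 0)))"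
proof (cases "leaves K = {}")
  case False
  then show ?thesis
    using hull_number_on_leaves[OF K nu] by simp
next
  case L: True
  show ?thesis
  proof (cases "\<exists>a b c. a \<in> K \<and> adj a b \<and> adj b c \<and> adj a c")
    case True
    then obtain a b c where abc: "a \<in> K" "adj a b" "adj b c" "adj a c"
      by blast
    have "b \<in> K"
      using component_adj[OF K] abc by blast
    \<comment> \<open>Two of the three corners of a triangle agree on adjacency to
      \<open>r\<close>.\<close>
    then have "\<exists>y\<in>K. \<exists>z. adj y z \<and> adj r y = adj r z"
      using abc by (cases "adj r a"; cases "adj r b") blast+
    then show ?thesis
      using hull_number_on_triangle[OF K nu L abc] L by (simp add: numeral_2_eq_2)
  next
    case False
    then have tf: "\<forall>a\<in>K. \<forall>b c. adj a b \<longrightarrow> adj b c \<longrightarrow> \<not> adj a c"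
      by blast
    have "\<not> (\<exists>y\<in>K. \<exists>z. adj y z \<and> adj r y = adj r z)"
      using triangle_free_bipartite[OF K L tf r] by blast
    then show ?thesis
      using hull_number_on_triangle_free[OF K nu L tf] L by auto
  qed
qed

end

section \<open>Component labels\<close>

text \<open>The value 0 stands for a deleted vertex: it stays 0 and passes nothing on, so this acts
  on the subgraph induced by the vertices with positive values.\<close>

definition pull :: "'a ugraph \<Rightarrow> ('a \<Rightarrow> nat) \<Rightarrow> 'a \<Rightarrow> nat" where
  "pull G f v = (if f v = 0 then 0 else Max (insert (f v) (f ` {w. adjacent G v w})))"

definition label :: "'a ugraph \<Rightarrow> ('a \<Rightarrow> nat) \<Rightarrow> 'a \<Rightarrow> nat" where
  "label G f = pull G (pull G (pull G f))"

context sgraph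
begin

lemma pull_ge: "0 < f v \<Longrightarrow> v = w \<or> adj v w \<Longrightarrow> f w \<le> pull G f v"
  unfolding pull_def by (auto intro!: Max_ge)

lemma pull_eq_0 [simp]: "pull G f v = 0 \<longleftrightarrow> f v = 0"
proof (cases "f v = 0")
  case False
  then have "f v \<le> pull G f v"
    by (intro pull_ge) auto
  with False show ?thesis by simp
qed (simp add: pull_def)

lemma pull_attained:
  assumes "0 < f v"
  obtains w where "v = w \<or> adj v w" "pull G f v = f w"
proof -
  have "Max (insert (f v) (f ` nbrs v)) \<in> insert (f v) (f ` nbrs v)"
    by (rule Max_in) auto
  then show thesis
    using assms that unfolding pull_def by auto
qed

lemma label_attained:
  assumes "0 < f x"
  obtains y where "conn G {v. 0 < f v} x y" "label G f x = f y"
proof -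
  let ?S = "{v. 0 < f v}"
  let ?P = "\<lambda>g. \<forall>x. (g x = 0 \<longleftrightarrow> f x = 0) \<and> (0 < f x \<longrightarrow> (\<exists>y. conn G ?S x y \<and> g x = f y))"
  have step: "?P (pull G g)" if g: "?P g" for g
  proof (intro allI conjI impI)
    fix x show "pull G g x = 0 \<longleftrightarrow> f x = 0"
      using g by simp
  next
    fix x assume x: "0 < f x"
    then have "0 < g x"
      using g by (metis neq0_conv)
    then obtain w where w: "x = w \<or> adj x w" "pull G g x = g w"
      by (rule pull_attained)
    have "g x \<le> pull G g x"
      using pull_ge \<open>0 < g x\<close> by blast
    then have "0 < g w"
      using w(2) \<open>0 < g x\<close> by simp
    then have fw: "0 < f w"
      using g by (metis neq0_conv)
    then obtain y where y: "conn G ?S w y" "g w = f y"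
      using g by blast
    have "conn G ?S x w"
      using w(1) x fw by (auto intro: conn_edge)
    then show "\<exists>y. conn G ?S x y \<and> pull G g x = f y"
      using y w(2) conn_trans by metis
  qed
  have "\<exists>y. conn G ?S x y \<and> f x = f y" for x
    by (rule exI[of _ x]) simp
  then have "?P f"
    by blast
  then have "?P (label G f)"
    unfolding label_def by (intro step)
  then show thesis
    using assms that by blast
qed

lemma label_eq_0 [simp]: "label G f v = 0 \<longleftrightarrow> f v = 0"
  by (simp add: label_def)

end

context p4_sparse_graph
begin

text \<open>Five consecutive vertices of a shortest path would induce two paths on four vertices.\<close>

lemma conn_distance_three:
  assumes "conn G S x y" "x \<in> S"
  shows "\<exists>a\<in>S. \<exists>b\<in>S. (x = a \<or> adj x a) \<and> (a = b \<or> adj a b) \<and> (b = y \<or> adj b y)"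
  using assms(1)
proof (induction rule: conn_induct)
  case refl
  then show ?case
    using assms(2) by blast
next
  case (step y z)
  then obtain a b where ab: "a \<in> S" "b \<in> S" "x = a \<or> adj x a" "a = b \<or> adj a b" "b = y \<or> adj b y"
    by blast
  show ?case
  proof (rule ccontr)
    assume n: "\<not> ?case"
    have far: "\<not> ((x = p \<or> adj x p) \<and> (p = q \<or> adj p q) \<and> (q = z \<or> adj q z))"
      if "p \<in> S" "q \<in> S" for p q
      using n that by blast
    have e: "adj x a" "adj a b" "adj b y"
      using ab far[of a y] far[of b y] far[of a b] step(2,4) by blast+
    have ne: "\<not> adj x b" "\<not> adj x y" "\<not> adj a y"
      using far[of b y] far[of y y] far[of a y] ab e step(2,4) by blast+
    then have P: "p4 x a b y"
      using e by (simp add: p4_def)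
    have nz: "\<not> adj z x" "\<not> adj z a" "\<not> adj z b" "z \<noteq> x" "z \<noteq> a" "z \<noteq> b" "z \<noteq> y"
      using far[of x x] far[of a a] far[of a b] ab e step(4) assms(2) adj_sym by blast+
    have "adj z y" "z \<in> V"
      using step(4) adj_sym adj_verts by blast+
    then show False
      using p4_neighbour_type[OF P, of z] nz by blast
  qed
qed

text \<open>Each round carries the value of \<open>y\<close> one step back along a path
  \<open>x\<close>, \<open>a\<close>, \<open>b\<close>, \<open>y\<close> in the support of
  \<open>f\<close>; closed neighbourhoods allow a step to stand still.\<close>

lemma label_ge:
  assumes "conn G {v. 0 < f v} x y" "0 < f x"
  shows "f y \<le> label G f x"
proof -
  obtain a b where ab: "0 < f a" "0 < f b" "x = a \<or> adj x a" "a = b \<or> adj a b" "b = y \<or> adj b y"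
    using conn_distance_three[OF assms(1)] assms(2) by auto
  have "f y \<le> pull G f b"
    using ab by (intro pull_ge)
  also have "\<dots> \<le> pull G (pull G f) a"
    using ab by (intro pull_ge) (auto simp: neq0_conv[symmetric] simp del: neq0_conv)
  also have "\<dots> \<le> label G f x"
    unfolding label_def using ab assms(2)
    by (intro pull_ge) (auto simp: neq0_conv[symmetric] simp del: neq0_conv)
  finally show ?thesis .
qed

text \<open>A label is a value attained in the component, so by injectivity equal labels come from
  one common vertex.\<close>

lemma label_eq_iff:
  assumes inj: "inj_on f {v. 0 < f v}" and xy: "0 < f x" "0 < f y"
  shows "label G f x = label G f y \<longleftrightarrow> conn G {v. 0 < f v} x y"
proof
  assume eq: "label G f x = label G f y"
  obtain x' where x': "conn G {v. 0 < f v} x x'" "label G f x = f x'"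
    using xy(1) by (rule label_attained)
  obtain y' where y': "conn G {v. 0 < f v} y y'" "label G f y = f y'"
    using xy(2) by (rule label_attained)
  have "0 < f x'" "0 < f y'"
    using conn_mem[OF x'(1)] conn_mem[OF y'(1)] xy by auto
  then have "x' = y'"
    using inj_onD[OF inj, of x' y'] eq x' y' by simp
  then show "conn G {v. 0 < f v} x y"
    using x' y' conn_sym conn_trans by metis
next
  have le: "label G f q \<le> label G f p" if pq: "conn G {v. 0 < f v} p q" "0 < f p" "0 < f q" for p q
  proof -
    obtain q' where "conn G {v. 0 < f v} q q'" "label G f q = f q'"
      using pq(3) by (rule label_attained)
    then show ?thesis
      using label_ge[of f p q'] pq conn_trans by metis
  qed
  assume "conn G {v. 0 < f v} x y"
  then show "label G f x = label G f y"
    using le[of x y] le[of y x] xy conn_sym by fastforce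
qed

lemma card_nbrs_universal:
  assumes K: "component K" and v: "v \<in> K"
  shows "card (nbrs v) + 1 = card K \<longleftrightarrow> universal_in K v"
proof -
  have sub: "nbrs v \<subseteq> K - {v}"
    using component_adj[OF K v] by auto
  have fin: "finite (K - {v})"
    using component_finite[OF K] by blast
  have "card K = card (K - {v}) + 1"
    using card_Suc_Diff1[OF component_finite[OF K] v] by simp
  then have "card (nbrs v) + 1 = card K \<longleftrightarrow> nbrs v = K - {v}"
    using card_subset_eq[OF fin sub] by fastforce
  also have "\<dots> \<longleftrightarrow> universal_in K v"
    using sub v unfolding universal_in_def by blast
  finally show ?thesis .
qed

end

text \<open>\<open>univ\<close> is left as loose as possible: of several universal vertices of a
  component any one may be recorded, and 0, which numbers no vertex, records that there is none. The
  test compares degree and component size, so it needs no look at the neighbours.\<close>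

locale numbered_p4_sparse_graph = p4_sparse_graph +
  fixes num :: "'a \<Rightarrow> nat" and univ :: "nat \<Rightarrow> nat"
  assumes num_inj: "inj_on num V" and num_pos: "\<And>v. 0 < num v \<longleftrightarrow> v \<in> V"
    and univ: "\<And>k. (univ k = 0 \<and>
        \<not> (\<exists>v\<in>V. label G num v = k \<and> card (nbrs v) + 1 = card {w \<in> V. label G num w = label G num v})) \<or>
      (\<exists>v\<in>V. label G num v = k \<and> card (nbrs v) + 1 = card {w \<in> V. label G num w = label G num v} \<and>
        univ k = num v)"
begin

abbreviation lab :: "'a \<Rightarrow> nat" where
  "lab \<equiv> label G num"

text \<open>Deletes one recorded universal vertex from each component that has one, all at the same
  time.\<close>

definition num' :: "'a \<Rightarrow> nat" where
  "num' v = (if univ (lab v) = num v then 0 else num v)"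

abbreviation lab' :: "'a \<Rightarrow> nat" where
  "lab' \<equiv> label G num'"

text \<open>The vertex numbered \<open>lab v\<close> represents the component of \<open>v\<close>.
  It is the vertex \<open>r\<close> of the triangle test.\<close>

definition marked :: "'a \<Rightarrow> bool" where
  "marked v \<longleftrightarrow> (\<exists>w. adj v w \<and> num w = lab v)"

definition flag :: "nat \<Rightarrow> nat" where
  "flag k = (if \<exists>v\<in>V. lab v = k \<and> (card (nbrs v) = 1 \<or> (\<exists>w. adj v w \<and> marked w = marked v))
     then 1 else 0)"

text \<open>Splits the hull number of a component among its vertices, which spares a loop over
  components. A vertex whose number is its own label is a representative; for \<open>lab'\<close>
  the representatives count the components left after the removal of the universal vertex.\<close>

definition weight :: "'a \<Rightarrow> nat" where
  "weight v = (if 0 < univ (lab v)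
     then (if univ (lab v) = num v then 1 else 0) + (if lab' v = num v then 1 else 0)
     else (if card (nbrs v) = 1 then 1 else 0) + (if lab v = num v then 3 - flag (lab v) else 0))"

lemma num_support: "{v. 0 < num v} = V"
  using num_pos by blast

lemma lab_eq_iff: "x \<in> V \<Longrightarrow> y \<in> V \<Longrightarrow> lab x = lab y \<longleftrightarrow> conn G V x y"
  using label_eq_iff[of num x y] num_inj num_pos num_support by simp

lemma lab_attained:
  assumes "x \<in> V"
  obtains y where "y \<in> V" "lab x = num y" "lab y = num y"
proof -
  obtain y where y: "conn G V x y" "lab x = num y"
    using label_attained[of num x] assms num_pos num_support by metis
  then have "y \<in> V" "lab y = lab x"
    using conn_mem assms lab_eq_iff by metis+
  with y that show thesis by simp
qed

lemma component_lab:
  assumes "x \<in> V"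
  shows "component {v \<in> V. lab v = lab x}"
proof -
  have "y \<in> V \<and> lab y = lab x \<longleftrightarrow> conn G V v y" if "v \<in> V" "lab v = lab x" for v y
    using that lab_eq_iff[of v y] conn_mem[of G V v y] by metis
  then show ?thesis
    using assms unfolding component_def by auto
qed

lemma sum_indicator: "finite A \<Longrightarrow> (\<Sum>v\<in>A. if P v then 1 else (0::nat)) = card {v \<in> A. P v}"
  by (simp add: sum.If_cases Int_def)

section \<open>The hull number as a sum of weights\<close>

lemma hull_number_on_weight_universal:
  assumes r: "r \<in> V" and u: "0 < univ (lab r)"
  shows "hull_number_on {v \<in> V. lab v = lab r} (\<Sum>v | v \<in> V \<and> lab v = lab r. weight v)"
proof -
  let ?K = "{v \<in> V. lab v = lab r}"
  have K: "component ?K"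
    by (rule component_lab[OF r])
  obtain u where u: "u \<in> ?K" "universal_in ?K u" "univ (lab r) = num u"
    using univ[of "lab r"] card_nbrs_universal[OF K] assms(2) by auto
  \<comment> \<open>The support of \<open>num'\<close> also misses the universal vertices recorded
    for other components, so it is compared with \<open>?K - {u}\<close> only inside
    \<open>?K\<close>.\<close>
  let ?S = "{v. 0 < num' v}"
  have num'_eq: "num' v = num v" "v \<in> V" if "0 < num' v" for v
    using that num_pos[of v] by (auto simp: num'_def split: if_splits)
  have inj': "inj_on num' ?S"
  proof (rule inj_onI)
    fix v w assume "v \<in> ?S" "w \<in> ?S" "num' v = num' w"
    then show "v = w"
      using num'_eq[of v] num'_eq[of w] inj_onD[OF num_inj, of v w] by simp
  qed
  have num_eq: "v = u" if "v \<in> ?K" "num v = num u" for v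
    using that u(1) inj_onD[OF num_inj, of v u] by blast
  have "0 < num' v \<longleftrightarrow> v \<noteq> u" if v: "v \<in> ?K" for v
    using num_eq[OF v] v u(3) num_pos[of v] by (auto simp: num'_def)
  then have SK: "?S \<inter> ?K = ?K - {u}"
    using u(1) by blast
  let ?D = "{v \<in> ?K. lab' v = num v}"
  \<comment> \<open>This keeps \<open>u\<close> from being counted a second time as a
    representative.\<close>
  have "lab' u = 0"
    using u by (simp add: num'_def)
  moreover have "0 < num u"
    using u(1) num_pos by blast
  ultimately have "u \<notin> ?D"
    by (simp del: label_eq_0)
  define f where "f x = inv_into V num (lab' x)" for x
  have f_num: "f x = y" if "lab' x = num y" "y \<in> V" for x y
    using that num_inj by (simp add: f_def)
  have "hull_number_on ?K (1 + card ?D)"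
  proof (rule hull_number_on_universal[OF K u(2), of ?D f])
    show "?D \<subseteq> ?K - {u}"
      using \<open>u \<notin> ?D\<close> by blast
    fix x assume x: "x \<in> ?K - {u}"
    then have xS: "x \<in> ?S"
      using SK by blast
    then obtain y where y: "conn G ?S x y" "lab' x = num' y"
      using label_attained[of num' x] by auto
    have yK: "y \<in> ?K" "conn G (?K - {u}) x y"
      using component_conn[OF K y(1)] x SK by auto
    have "y \<in> ?S"
      using conn_mem[OF y(1) xS] .
    then have ny: "num' y = num y" "lab' y = lab' x"
      using label_eq_iff[OF inj', of x y] xS y(1) by (auto simp: num'_def split: if_splits)
    then have "f x = y"
      using f_num yK(1) y(2) by auto
    then show "f x \<in> ?D \<and> conn G (?K - {u}) (f x) x"
      using yK ny y(2) conn_sym by auto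
  next
    fix x y assume x: "x \<in> ?K - {u}" and xy: "conn G (?K - {u}) x y"
    have "conn G ?S x y"
      by (rule conn_mono[OF xy]) (use SK in blast)
    moreover have "x \<in> ?S"
      using x SK by blast
    moreover have "y \<in> ?S"
      using conn_mem[OF calculation] .
    ultimately have "lab' x = lab' y"
      using label_eq_iff[OF inj', of x y] by simp
    then show "f x = f y"
      by (simp add: f_def)
  next
    fix d assume "d \<in> ?D"
    then show "f d = d"
      using f_num by auto
  qed
  moreover have "(\<Sum>v\<in>?K. weight v) = 1 + card ?D"
  proof -
    have "(\<Sum>v\<in>?K. weight v) = (\<Sum>v\<in>?K. (if v = u then 1 else 0) + (if lab' v = num v then 1 else 0))"
    proof (rule sum.cong)
      fix v assume "v \<in> ?K"
      then show "weight v = (if v = u then 1 else 0) + (if lab' v = num v then 1 else 0)"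
        using num_eq[of v] u(3) assms(2) unfolding weight_def by auto
    qed simp
    also have "\<dots> = card {v \<in> ?K. v = u} + card ?D"
      using component_finite[OF K] by (simp only: sum.distrib sum_indicator)
    also have "{v \<in> ?K. v = u} = {u}"
      using u(1) by blast
    finally show ?thesis by simp
  qed
  ultimately show ?thesis by simp
qed

lemma hull_number_on_weight_non_universal:
  assumes r: "r \<in> V" "lab r = num r" and u: "univ (lab r) = 0"
  shows "hull_number_on {v \<in> V. lab v = lab r} (\<Sum>v | v \<in> V \<and> lab v = lab r. weight v)"
proof -
  let ?K = "{v \<in> V. lab v = lab r}"
  have K: "component ?K"
    by (rule component_lab[OF r(1)])
  have fin: "finite ?K"
    by (rule component_finite[OF K])
  have rK: "r \<in> ?K"
    using r by simp
  have nu: "\<not> universal_in ?K v" for v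
  proof
    assume v: "universal_in ?K v"
    then have "v \<in> ?K"
      by (simp add: universal_in_def)
    then have "card (nbrs v) + 1 = card {w \<in> V. lab w = lab v}"
      using card_nbrs_universal[OF K, of v] v by simp
    with \<open>v \<in> ?K\<close> obtain w where "w \<in> V" "univ (lab r) = num w"
      using univ[of "lab r"] by blast
    then show False
      using u num_pos[of w] by simp
  qed
  have marked: "marked v \<longleftrightarrow> adj r v" if v: "v \<in> ?K" for v
  proof -
    have "w = r" if "num w = num r" for w
      using that num_inj num_pos[of w] num_pos[of r] r by (auto simp: inj_on_def)
    then show ?thesis
      using v r adj_sym unfolding marked_def by auto
  qed
  have "marked w = marked v \<longleftrightarrow> adj r v = adj r w" if "v \<in> ?K" "adj v w" for v w
    using marked[OF that(1)] marked[OF component_adj[OF K that]] by blast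
  then have "(\<exists>v\<in>?K. card (nbrs v) = 1 \<or> (\<exists>w. adj v w \<and> marked w = marked v)) \<longleftrightarrow>
      leaves ?K \<noteq> {} \<or> (\<exists>y\<in>?K. \<exists>z. adj y z \<and> adj r y = adj r z)"
    unfolding leaves_def by blast
  moreover have "flag (lab r) =
      (if \<exists>v\<in>?K. card (nbrs v) = 1 \<or> (\<exists>w. adj v w \<and> marked w = marked v) then 1 else 0)"
    unfolding flag_def by (rule if_cong) auto
  ultimately have "hull_number_on ?K (card (leaves ?K) + (3 - flag (lab r)))"
    using hull_number_on_non_universal[OF K nu rK] by presburger
  moreover have "(\<Sum>v\<in>?K. weight v) = card (leaves ?K) + (3 - flag (lab r))"
  proof -
    have "(\<Sum>v\<in>?K. weight v) =
        (\<Sum>v\<in>?K. (if card (nbrs v) = 1 then 1 else 0) + (if v = r then 3 - flag (lab r) else 0))"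
    proof (rule sum.cong)
      fix v assume v: "v \<in> ?K"
      then have "lab v = num v \<longleftrightarrow> v = r"
        using r num_inj by (auto simp: inj_on_def)
      then show "weight v = (if card (nbrs v) = 1 then 1 else 0) + (if v = r then 3 - flag (lab r) else 0)"
        using v u unfolding weight_def by auto
    qed simp
    also have "\<dots> = card {v \<in> ?K. card (nbrs v) = 1} + (3 - flag (lab r))"
      using fin rK by (simp only: sum.distrib sum_indicator sum.delta if_True)
    finally show ?thesis
      by (simp only: leaves_def)
  qed
  ultimately show ?thesis by simp
qed

theorem hn_cc_eq_sum_weight: "hn_cc G = (\<Sum>v\<in>V. weight v)"
proof -
  let ?R = "{r \<in> V. lab r = num r}"
  let ?K = "\<lambda>r. {v \<in> V. lab v = lab r}"
  have cover: "(\<Union>r\<in>?R. ?K r) = V"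
  proof -
    have "\<exists>r\<in>?R. v \<in> ?K r" if "v \<in> V" for v
      using lab_attained[OF that] that by (metis (mono_tags, lifting) mem_Collect_eq)
    then show ?thesis by blast
  qed
  have disj: "?K r \<inter> ?K s = {}" if "r \<in> ?R" "s \<in> ?R" "r \<noteq> s" for r s
    using that inj_onD[OF num_inj, of r s] by auto
  have fin: "finite ?R"
    using finite_V by simp
  have "hull_number_on (?K r) (\<Sum>v\<in>?K r. weight v)" if "r \<in> ?R" for r
  proof (cases "univ (lab r) = 0")
    case True
    with that show ?thesis
      by (intro hull_number_on_weight_non_universal) auto
  next
    case False
    with that show ?thesis
      by (intro hull_number_on_weight_universal) auto
  qed
  then have "hn_cc G = (\<Sum>r\<in>?R. \<Sum>v\<in>?K r. weight v)"
    by (intro hn_cc_eq_sum[OF fin cover disj])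
  also have "\<dots> = (\<Sum>v\<in>(\<Union>r\<in>?R. ?K r). weight v)"
    by (rule sum.UNION_disjoint[symmetric]) (use fin disj in auto)
  finally show ?thesis
    by (simp only: cover)
qed

end

section \<open>Programs that sweep over the adjacency lists\<close>

definition runs :: "nat \<Rightarrow> com \<Rightarrow> state \<Rightarrow> nat \<Rightarrow> (state \<Rightarrow> bool) \<Rightarrow> bool" where
  "runs w c s T Q \<longleftrightarrow> (\<exists>t s'. exec w c s t s' \<and> t \<le> T \<and> Q s')"

definition upd :: "state \<Rightarrow> string \<Rightarrow> nat \<Rightarrow> state" where
  "upd s x v = ((fst s)(x := v), snd s)"

lemma upd_simps [simp]:
  "fst (upd s x v) y = (if y = x then v else fst s y)"
  "snd (upd s x v) = snd s"
  by (simp_all add: upd_def)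

lemma runs_Skip: "Q s \<Longrightarrow> 1 \<le> T \<Longrightarrow> runs w Skip s T Q"
  unfolding runs_def using exec.Skip by blast

lemma runs_Assign:
  "fits w s e \<Longrightarrow> Q (upd s x (val s e)) \<Longrightarrow> 1 + cost e \<le> T \<Longrightarrow> runs w (Assign x e) s T Q"
  unfolding runs_def upd_def using exec.Assign by blast

lemma runs_Write:
  "fits w s a \<Longrightarrow> fits w s e \<Longrightarrow> Q (fst s, (snd s)(val s a := val s e)) \<Longrightarrow>
    1 + cost a + cost e \<le> T \<Longrightarrow> runs w (Write a e) s T Q"
  unfolding runs_def using exec.Write by blast

lemma runs_Seq:
  assumes "runs w c1 s T1 P" and "\<And>s. P s \<Longrightarrow> runs w c2 s T2 Q" and "T1 + T2 \<le> T"
  shows "runs w (Seq c1 c2) s T Q"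
proof -
  obtain t1 s1 where 1: "exec w c1 s t1 s1" "t1 \<le> T1" "P s1"
    using assms(1) unfolding runs_def by blast
  then obtain t2 s2 where 2: "exec w c2 s1 t2 s2" "t2 \<le> T2" "Q s2"
    using assms(2) unfolding runs_def by blast
  show ?thesis
    unfolding runs_def using exec.Seq[OF 1(1) 2(1)] 1 2 assms(3)
    by (intro exI[of _ "t1 + t2"] exI[of _ s2]) simp
qed

lemma runs_Assign_Seq:
  assumes "fits w s e" and "val s e = v" and "runs w c (upd s x v) T Q" and "1 + cost e + T \<le> T'"
  shows "runs w (Seq (Assign x e) c) s T' Q"
  by (rule runs_Seq[where P = "\<lambda>s'. s' = upd s x v", OF runs_Assign[OF assms(1) _ order_refl]])
    (use assms in auto)

lemma runs_IfLess:
  assumes "fits w s a" "fits w s b"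
    and "val s a < val s b \<Longrightarrow> runs w c1 s T Q" and "\<not> val s a < val s b \<Longrightarrow> runs w c2 s T Q"
    and T': "1 + cost a + cost b + T \<le> T'"
  shows "runs w (IfLess a b c1 c2) s T' Q"
proof (cases "val s a < val s b")
  case True
  then obtain t s' where "exec w c1 s t s'" "t \<le> T" "Q s'"
    using assms(3) unfolding runs_def by blast
  then show ?thesis
    unfolding runs_def using exec.IfTrue[OF assms(1,2) True] T' by (meson add_left_mono le_trans)
next
  case False
  then obtain t s' where "exec w c2 s t s'" "t \<le> T" "Q s'"
    using assms(4) unfolding runs_def by blast
  then show ?thesis
    unfolding runs_def using exec.IfFalse[OF assms(1,2) False] T' by (meson add_left_mono le_trans)
qed

text \<open>The number of iterations is known beforehand, and each has its own budget
  \<open>T k\<close>. This is what linear time needs: a visit may cost as much as the degree of the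
  vertex, and only the sum is bounded.\<close>

lemma runs_WhileLess:
  assumes "I 0 s"
    and "\<And>k s. k < m \<Longrightarrow> I k s \<Longrightarrow>
      fits w s a \<and> fits w s b \<and> val s a < val s b \<and> runs w c s (T k) (I (Suc k))"
    and "\<And>s. I m s \<Longrightarrow> fits w s a \<and> fits w s b \<and> \<not> val s a < val s b \<and> Q s"
    and "(\<Sum>k<m. T k + (1 + cost a + cost b)) + (1 + cost a + cost b) \<le> T'"
  shows "runs w (WhileLess a b c) s T' Q"
  using assms
proof (induction m arbitrary: I T T' s)
  case 0
  then show ?case
    unfolding runs_def using exec.WhileFalse[of w s a b c] 0(3)[OF 0(1)] 0(4)
    by (intro exI[of _ "1 + cost a + cost b"] exI[of _ s]) simp
next
  case (Suc m)
  let ?U = "(\<Sum>k<m. T (Suc k) + (1 + cost a + cost b)) + (1 + cost a + cost b)"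
  have 1: "fits w s a" "fits w s b" "val s a < val s b" "runs w c s (T 0) (I (Suc 0))"
    using Suc.prems(2)[of 0 s] Suc.prems(1) by auto
  then obtain t1 s1 where s1: "exec w c s t1 s1" "t1 \<le> T 0" "I (Suc 0) s1"
    unfolding runs_def by blast
  have "runs w (WhileLess a b c) s1 ?U Q"
  \<comment> \<open>What remains after one iteration is the same loop with invariant and budgets
    shifted by one.\<close>
  proof (rule Suc.IH[of "\<lambda>k. I (Suc k)" _ "\<lambda>k. T (Suc k)"])
    show "I (Suc 0) s1"
      by (rule s1(3))
    fix k s assume "k < m" "I (Suc k) s"
    then show "fits w s a \<and> fits w s b \<and> val s a < val s b \<and> runs w c s (T (Suc k)) (I (Suc (Suc k)))"
      using Suc.prems(2)[of "Suc k" s] by simp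
  qed (use Suc.prems(3) in auto)
  then obtain t2 s2 where s2: "exec w (WhileLess a b c) s1 t2 s2" "t2 \<le> ?U" "Q s2"
    unfolding runs_def by blast
  have "1 + cost a + cost b + t1 + t2 \<le> T'"
    using s1(2) s2(2) Suc.prems(4) by (simp add: sum.lessThan_Suc_shift del: sum.lessThan_Suc)
  then show ?case
    unfolding runs_def using exec.WhileTrue[OF 1(1-3) s1(1) s2(1)] s2(3) by blast
qed

section \<open>Word bounds\<close>

fun nums_le :: "nat \<Rightarrow> expr \<Rightarrow> bool" where
  "nums_le B (Num k) \<longleftrightarrow> k \<le> B"
| "nums_le B (Reg x) \<longleftrightarrow> True"
| "nums_le B (Mem a) \<longleftrightarrow> nums_le B a"
| "nums_le B (Plus a b) \<longleftrightarrow> nums_le B a \<and> nums_le B b"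
| "nums_le B (Minus a b) \<longleftrightarrow> nums_le B a \<and> nums_le B b"

definition bounded_state :: "nat \<Rightarrow> state \<Rightarrow> bool" where
  "bounded_state B s \<longleftrightarrow> (\<forall>x. fst s x \<le> B) \<and> (\<forall>a. snd s a \<le> B)"

lemma bounded_upd: "bounded_state B s \<Longrightarrow> v \<le> B \<Longrightarrow> bounded_state B (upd s x v)"
  by (simp add: bounded_state_def)

lemma val_bounded:
  assumes "bounded_state B s"
  shows "nums_le B e \<Longrightarrow> val s e \<le> cost e * B"
proof (induction e)
  case (Mem a)
  have "val s (Mem a) \<le> B"
    using assms by (simp add: bounded_state_def)
  then show ?case
    by (simp add: trans_le_add1)
qed (use assms in \<open>auto simp: bounded_state_def algebra_simps intro: le_trans\<close>)

text \<open>Registers, cells and literals contribute at most \<open>B\<close> each, and only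
  additions make values grow, so every intermediate result is at most its cost times
  \<open>B\<close>.\<close>

lemma fits_bounded:
  assumes s: "bounded_state B s"
  shows "nums_le B e \<Longrightarrow> cost e * B \<le> w \<Longrightarrow> fits w s e"
proof (induction e)
  case (Plus a b)
  have "val s a + val s b \<le> cost (Plus a b) * B"
    using val_bounded[OF s, of a] val_bounded[OF s, of b] Plus.prems(1) by (simp add: algebra_simps)
  with Plus show ?case
    by (simp add: algebra_simps)
next
  case (Mem a)
  have "snd s (val s a) \<le> B"
    using s by (simp add: bounded_state_def)
  with Mem show ?case
    by simp
next
  case (Num k)
  then show ?case by simp
next
  case (Reg x)
  then show ?case
    using s by (auto simp: bounded_state_def intro: le_trans)
next
  case (Minus a b)
  then show ?case
    by (simp add: algebra_simps)
qed

text \<open>1000 is the factor by which the word bound exceeds \<open>B\<close>, and 13 is a lower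
  bound on \<open>B\<close> guaranteed by the room for thirteen arrays.\<close>

definition small :: "expr \<Rightarrow> bool" where
  "small e \<longleftrightarrow> cost e \<le> 1000 \<and> nums_le 13 e"

primrec mul :: "nat \<Rightarrow> expr \<Rightarrow> expr" where
  "mul 0 e = Num 0"
| "mul (Suc k) e = Plus e (mul k e)"

lemma mul_simps [simp]:
  "val s (mul k e) = k * val s e"
  "cost (mul k e) = k * (cost e + 1) + 1"
  "nums_le B (mul k e) \<longleftrightarrow> k = 0 \<or> nums_le B e"
  by (induction k) auto

text \<open>Of the two truncated differences at most one is positive, so this is the absolute
  difference; subtracting it from 1 tests equality without a branch.\<close>

definition dist_expr :: "expr \<Rightarrow> expr \<Rightarrow> expr" where
  "dist_expr a b = Plus (Minus a b) (Minus b a)"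

definition eq_expr :: "expr \<Rightarrow> expr \<Rightarrow> expr" where
  "eq_expr a b = Minus (Num 1) (dist_expr a b)"

lemma dist_expr_simps [simp]:
  "val s (dist_expr a b) = (val s a - val s b) + (val s b - val s a)"
  "cost (dist_expr a b) = 3 + 2 * (cost a + cost b)"
  "nums_le B (dist_expr a b) \<longleftrightarrow> nums_le B a \<and> nums_le B b"
  by (auto simp: dist_expr_def)

lemma eq_expr_simps [simp]:
  "val s (eq_expr a b) = (if val s a = val s b then 1 else 0)"
  "cost (eq_expr a b) = 5 + 2 * (cost a + cost b)"
  "nums_le B (eq_expr a b) \<longleftrightarrow> 1 \<le> B \<and> nums_le B a \<and> nums_le B b"
  by (auto simp: eq_expr_def)

text \<open>The arrays follow the input: \<open>b\<close> holds its length and \<open>st\<close> the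
  array size \<open>n + 1\<close>, which admits vertices, counted from 0, as well as labels, which
  go up to \<open>n\<close>, as indices. The factor \<open>k\<close> is fixed in the program, so the
  product unrolls into additions.\<close>

definition cell :: "nat \<Rightarrow> expr \<Rightarrow> expr" where
  "cell k e = Plus (mul k (Reg ''st'')) (Plus (Reg ''b'') e)"

definition get :: "nat \<Rightarrow> expr \<Rightarrow> expr" where
  "get k e = Mem (cell k e)"

lemma cell_simps [simp]:
  "cost (cell k e) = 2 * k + 4 + cost e"
  "nums_le B (cell k e) \<longleftrightarrow> nums_le B e"
  "cost (get k e) = 2 * k + 5 + cost e"
  "nums_le B (get k e) \<longleftrightarrow> nums_le B e"
  by (auto simp: cell_def get_def)

text \<open>For each vertex \<open>i\<close>, the loop body sets \<open>acc\<close> to the maximum of \<open>e0\<close> and of the values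
  of \<open>e1\<close> over the neighbours \<open>w\<close> of \<open>i\<close> and then, provided that \<open>c1 < c2\<close>, stores \<open>v\<close> at
  index \<open>ix\<close> of the array \<open>t\<close>.\<close>

definition visit :: "expr \<Rightarrow> expr \<Rightarrow> com" where
  "visit e0 e1 =
     Seq (Assign ''acc'' e0)
       (WhileLess (Reg ''p'') (Reg ''e'')
         (Seq (Assign ''p'' (Plus (Reg ''p'') (Num 1)))
         (Seq (Assign ''w'' (Mem (Reg ''p'')))
           (IfLess (Reg ''acc'') e1 (Assign ''acc'' e1) Skip))))"

definition sweep :: "expr \<Rightarrow> expr \<Rightarrow> expr \<Rightarrow> expr \<Rightarrow> nat \<Rightarrow> expr \<Rightarrow> expr \<Rightarrow> com" where
  "sweep e0 e1 c1 c2 t ix v =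
     Seq (Assign ''i'' (Num 0))
     (Seq (Assign ''p'' (Num 1))
       (WhileLess (Reg ''i'') (Reg ''n'')
         (Seq (Assign ''d'' (Mem (Reg ''p'')))
         (Seq (Assign ''e'' (Plus (Reg ''p'') (Reg ''d'')))
         (Seq (visit e0 e1)
         (Seq (IfLess c1 c2 (Write (cell t ix) v) Skip)
         (Seq (Assign ''p'' (Plus (Reg ''p'') (Num 1)))
           (Assign ''i'' (Plus (Reg ''i'') (Num 1))))))))))"

text \<open>The input does not tell its own length, so the loop hops from degree to degree until it
  is past the last block. Register \<open>i\<close> is 0 at the start by
  \<open>init_state\<close>.\<close>

definition prepare :: com where
  "prepare =
     Seq (Assign ''n'' (Mem (Num 0)))
     (Seq (Assign ''p'' (Num 1))
     (Seq (WhileLess (Reg ''i'') (Reg ''n'')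
         (Seq (Assign ''p'' (Plus (Reg ''p'') (Plus (Num 1) (Mem (Reg ''p'')))))
           (Assign ''i'' (Plus (Reg ''i'') (Num 1)))))
     (Seq (Assign ''b'' (Reg ''p''))
       (Assign ''st'' (Plus (Reg ''n'') (Num 1))))))"

section \<open>Memory layout\<close>

locale adjacency_input =
  fixes ls :: "nat list list" and B W :: nat
  assumes ls_less: "\<And>l w. l \<in> set ls \<Longrightarrow> w \<in> set l \<Longrightarrow> w < length ls"
    and B: "length (length ls # concat (map (\<lambda>l. length l # l) ls)) + 13 * (length ls + 1) \<le> B"
    and W: "1000 * B \<le> W"
begin

abbreviation n :: nat where
  "n \<equiv> length ls"

definition input :: "nat list" where
  "input = n # concat (map (\<lambda>l. length l # l) ls)"

definition pos :: "nat \<Rightarrow> nat" where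
  "pos i = Suc (length (concat (map (\<lambda>l. length l # l) (take i ls))))"

abbreviation len :: nat where
  "len \<equiv> length input"

text \<open>\<open>B\<close> covers the input and thirteen arrays of \<open>n + 1\<close> cells,
  hence every address in use; it will also bound all stored values.\<close>

lemma B_bounds: "13 \<le> B" "n \<le> B" "len \<le> B" "13 * (n + 1) \<le> B"
  using B by (auto simp: input_def)

lemma pos_0 [simp]: "pos 0 = 1"
  by (simp add: pos_def)

lemma pos_n [simp]: "pos n = len"
  by (simp add: pos_def input_def)

lemma pos_Suc: "i < n \<Longrightarrow> pos (Suc i) = pos i + Suc (length (ls ! i))"
  by (simp add: pos_def take_Suc_conv_app_nth)

lemma input_split:
  assumes "i < n"
  shows "\<exists>us vs. input = us @ length (ls ! i) # ls ! i @ vs \<and> length us = pos i"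
proof -
  let ?f = "\<lambda>l. length l # l"
  have "input = n # concat (map ?f (take i ls @ ls ! i # drop (Suc i) ls))"
    unfolding input_def using assms by (simp add: id_take_nth_drop[symmetric])
  then have "input = (n # concat (map ?f (take i ls))) @ length (ls ! i) # ls ! i @
      concat (map ?f (drop (Suc i) ls))"
    by simp
  moreover have "length (n # concat (map ?f (take i ls))) = pos i"
    by (simp add: pos_def)
  ultimately show ?thesis by blast
qed

lemma input_degree: "i < n \<Longrightarrow> input ! pos i = length (ls ! i)"
  using input_split[of i] by (auto simp: nth_append)

lemma input_neighbour:
  "i < n \<Longrightarrow> k < length (ls ! i) \<Longrightarrow> input ! Suc (pos i + k) = ls ! i ! k"
  using input_split[of i] by (auto simp: nth_append)

lemma pos_degree_less: "i < n \<Longrightarrow> pos i + length (ls ! i) < len"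
  using input_split[of i] by auto

lemma input_le:
  assumes "x \<in> set input"
  shows "x \<le> B"
proof -
  have len: "length l \<le> len" if l: "l \<in> set ls" for l
  proof -
    obtain i where "i < n" "l = ls ! i"
      using l by (metis in_set_conv_nth)
    then show ?thesis
      using pos_degree_less[of i] by simp
  qed
  consider "x = n" | l where "l \<in> set ls" "x = length l" | l where "l \<in> set ls" "x \<in> set l"
    using assms unfolding input_def by auto
  then show ?thesis
  proof cases
    case 1
    then show ?thesis
      using B_bounds by simp
  next
    case (2 l)
    then show ?thesis
      using len[of l] B_bounds by simp
  next
    case (3 l)
    then show ?thesis
      using ls_less[of l x] B_bounds by simp
  qed
qed

definition repr :: "(nat \<Rightarrow> nat \<Rightarrow> nat) \<Rightarrow> state \<Rightarrow> bool" where
  "repr A s \<longleftrightarrow> fst s ''n'' = n \<and> fst s ''b'' = len \<and> fst s ''st'' = n + 1 \<and>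
     (\<forall>i<len. snd s i = input ! i) \<and>
     (\<forall>k<13. \<forall>j\<le>n. snd s (k * (n + 1) + (len + j)) = A k j) \<and> bounded_state B s"

lemma fits_small: "bounded_state B s \<Longrightarrow> small e \<Longrightarrow> fits W s e"
proof (rule fits_bounded)
  assume e: "small e"
  have "nums_le 13 e \<Longrightarrow> nums_le B e"
    using B_bounds by (induction e) auto
  then show "nums_le B e"
    using e by (simp add: small_def)
  have "cost e * B \<le> 1000 * B"
    using e by (simp add: small_def)
  then show "cost e * B \<le> W"
    using W by (rule le_trans)
qed

lemma runs_Assign_Seq_small:
  assumes "bounded_state B s" and "small e" and "val s e = v" and "runs W c (upd s x v) T Q"
    and "1 + cost e + T \<le> T'"
  shows "runs W (Seq (Assign x e) c) s T' Q"
  using runs_Assign_Seq[OF fits_small[OF assms(1,2)] assms(3-5)] .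

lemma repr_upd:
  "repr A s \<Longrightarrow> x \<notin> {''n'', ''b'', ''st''} \<Longrightarrow> v \<le> B \<Longrightarrow> repr A (upd s x v)"
  by (auto simp: repr_def bounded_upd)

text \<open>An index is at most \<open>n\<close> and thus a remainder modulo \<open>n + 1\<close>:
  array and index can be recovered from the address, so arrays do not overlap.\<close>

lemma cell_eq_iff:
  assumes "j \<le> n" "j' \<le> n"
  shows "k * (n + 1) + (len + j) = k' * (n + 1) + (len + j') \<longleftrightarrow> k = k' \<and> j = j'"
proof
  assume "k * (n + 1) + (len + j) = k' * (n + 1) + (len + j')"
  then have eq: "j + k * (n + 1) = j' + k' * (n + 1)"
    by simp
  have "(j + k * (n + 1)) div (n + 1) = k" "(j' + k' * (n + 1)) div (n + 1) = k'"
    using assms by (simp_all only: div_mult_self1 zero_neq_one add_is_0 simp_thms div_less le_imp_less_Suc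
        Suc_eq_plus1[symmetric] add_0_left nat.distinct not_False_eq_True)
  then have "k = k'"
    using eq by simp
  with eq show "k = k' \<and> j = j'"
    by simp
qed simp

lemma repr_write:
  assumes s: "repr A s" and "t < 13" "j \<le> n" "v \<le> B"
  shows "repr (A(t := (A t)(j := v))) (fst s, (snd s)(t * (n + 1) + (len + j) := v))"
proof -
  have "snd s (k * (n + 1) + (len + j')) = A k j'" if "k < 13" "j' \<le> n" for k j'
    using s that unfolding repr_def by blast
  then have "((snd s)(t * (n + 1) + (len + j) := v)) (k * (n + 1) + (len + j')) =
      (A(t := (A t)(j := v))) k j'" if "k < 13" "j' \<le> n" for k j'
    using cell_eq_iff[OF that(2) assms(3), of k t] that by auto
  moreover have "((snd s)(t * (n + 1) + (len + j) := v)) i = input ! i" if "i < len" for i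
    using s that by (auto simp: repr_def)
  moreover have "bounded_state B (fst s, (snd s)(t * (n + 1) + (len + j) := v))"
    using s assms(4) by (auto simp: repr_def bounded_state_def)
  ultimately show ?thesis
    using s unfolding repr_def by simp
qed

lemma val_cell: "repr A s \<Longrightarrow> val s (cell k e) = k * (n + 1) + (len + val s e)"
  by (simp add: repr_def cell_def)

lemma val_get: "repr A s \<Longrightarrow> k < 13 \<Longrightarrow> val s e \<le> n \<Longrightarrow> val s (get k e) = A k (val s e)"
  unfolding get_def using val_cell[of A s k e] by (simp add: repr_def)

section \<open>Running time of a sweep\<close>

lemma runs_visit:
  assumes i: "i < n" and l: "l = ls ! i"
    and s: "repr A s" "fst s ''i'' = i" "fst s ''d'' = length l" "fst s ''e'' = pos i + length l"
      "fst s ''p'' = pos i"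
    and small: "small e0" "small e1"
    and e0: "val s e0 = f0" "f0 \<le> B"
    and e1: "\<And>s w. repr A s \<Longrightarrow> fst s ''i'' = i \<Longrightarrow> fst s ''d'' = length l \<Longrightarrow> w \<in> set l \<Longrightarrow>
      fst s ''w'' = w \<Longrightarrow> val s e1 = f1 w \<and> f1 w \<le> B"
  shows "runs W (visit e0 e1) s (1010 + 2020 * length l)
    (\<lambda>s. repr A s \<and> fst s ''i'' = i \<and> fst s ''d'' = length l \<and> fst s ''p'' = pos i + length l \<and>
      fst s ''acc'' = Max (insert f0 (f1 ` set l)))"
proof -
  define J where "J k s \<longleftrightarrow> repr A s \<and> fst s ''i'' = i \<and> fst s ''d'' = length l \<and>
    fst s ''e'' = pos i + length l \<and> fst s ''p'' = pos i + k \<and>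
    fst s ''acc'' = Max (insert f0 (f1 ` set (take k l)))" for k s
  have bnd: "bounded_state B s" if "repr A s" for s
    using that by (simp add: repr_def)
  have pB: "pos i + k \<le> B" if "k \<le> length l" for k
    using pos_degree_less[OF i] that l B_bounds by simp
  show ?thesis
    unfolding visit_def
  proof (rule runs_Assign_Seq_small[OF bnd[OF s(1)] small(1) e0(1)])
    show "runs W (WhileLess (Reg ''p'') (Reg ''e'')
         (Seq (Assign ''p'' (Plus (Reg ''p'') (Num 1)))
         (Seq (Assign ''w'' (Mem (Reg ''p'')))
           (IfLess (Reg ''acc'') e1 (Assign ''acc'' e1) Skip)))) (upd s ''acc'' f0)
       (3 + 2020 * length l)
      (\<lambda>s. repr A s \<and> fst s ''i'' = i \<and> fst s ''d'' = length l \<and> fst s ''p'' = pos i + length l \<and>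
      fst s ''acc'' = Max (insert f0 (f1 ` set l)))"
    \<comment> \<open>The budget 2010 covers two evaluations of \<open>e1\<close>, one to compare
      and one to assign, at a cost of at most 1000 each.\<close>
    proof (rule runs_WhileLess[where I = J and m = "length l" and T = "\<lambda>_. 2010"])
      show "J 0 (upd s ''acc'' f0)"
        using s e0(2) by (simp add: J_def repr_upd)
    next
      fix k s assume k: "k < length l" and J: "J k s"
      have r: "repr A s" and p: "fst s ''p'' = pos i + k"
        using J by (simp_all add: J_def)
      let ?s1 = "upd s ''p'' (Suc (pos i + k))"
      let ?s2 = "upd ?s1 ''w'' (l ! k)"
      have r1: "repr A ?s1"
        using r pB[of "Suc k"] k by (intro repr_upd) auto
      have lk: "l ! k \<in> set l" "l ! k \<le> B"
        using k ls_less[of l "l ! k"] l i B_bounds by auto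
      have r2: "repr A ?s2"
        using lk by (intro repr_upd[OF r1]) auto
      have mem: "snd s (Suc (pos i + k)) = l ! k"
      proof -
        have "Suc (pos i + k) < len"
          using pos_degree_less[OF i] k l by simp
        then show ?thesis
          using r input_neighbour[OF i] k l by (simp add: repr_def)
      qed
      have v1: "val ?s2 e1 = f1 (l ! k)" "f1 (l ! k) \<le> B"
        using e1[OF r2, of "l ! k"] J lk by (auto simp: J_def)
      have acc: "Max (insert f0 (f1 ` set (take (Suc k) l))) = max (f1 (l ! k)) (fst s ''acc'')"
      proof -
        have "insert f0 (f1 ` set (take (Suc k) l)) = insert (f1 (l ! k)) (insert f0 (f1 ` set (take k l)))"
          using k by (auto simp: take_Suc_conv_app_nth)
        then show ?thesis
          using J by (simp add: J_def)
      qed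
      have "runs W (IfLess (Reg ''acc'') e1 (Assign ''acc'' e1) Skip) ?s2 2003 (J (Suc k))"
      proof (rule runs_IfLess)
        show "fits W ?s2 (Reg ''acc'')" "fits W ?s2 e1"
          using small by (auto intro!: fits_small[OF bnd[OF r2]] simp: small_def simp del: fits.simps)
        show "runs W (Assign ''acc'' e1) ?s2 1001 (J (Suc k))" if "val ?s2 (Reg ''acc'') < val ?s2 e1"
        proof (rule runs_Assign)
          show "fits W ?s2 e1"
            by (rule fits_small[OF bnd[OF r2] small(2)])
          have "repr A (upd ?s2 ''acc'' (f1 (l ! k)))"
            using v1 by (intro repr_upd[OF r2]) auto
          then show "J (Suc k) (upd ?s2 ''acc'' (val ?s2 e1))"
            using J that acc v1 by (simp add: J_def)
        qed (use small in \<open>simp add: small_def\<close>)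
        show "runs W Skip ?s2 1001 (J (Suc k))" if "\<not> val ?s2 (Reg ''acc'') < val ?s2 e1"
        proof (rule runs_Skip)
          have "f1 (l ! k) \<le> fst s ''acc''"
            using that v1 by simp
          then have "Max (insert f0 (f1 ` set (take (Suc k) l))) = fst s ''acc''"
            by (simp only: acc max_absorb2)
          then show "J (Suc k) ?s2"
            using J r2 by (simp add: J_def)
        qed simp
      qed (use small in \<open>simp add: small_def\<close>)
      then have "runs W (Seq (Assign ''w'' (Mem (Reg ''p'')))
           (IfLess (Reg ''acc'') e1 (Assign ''acc'' e1) Skip)) ?s1 2006 (J (Suc k))"
        by (rule runs_Assign_Seq_small[OF bnd[OF r1], rotated 2]) (use mem in \<open>auto simp: small_def\<close>)
      then have "runs W (Seq (Assign ''p'' (Plus (Reg ''p'') (Num 1)))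
         (Seq (Assign ''w'' (Mem (Reg ''p'')))
           (IfLess (Reg ''acc'') e1 (Assign ''acc'' e1) Skip))) s 2010 (J (Suc k))"
        by (rule runs_Assign_Seq_small[OF bnd[OF r], rotated 2]) (use p in \<open>auto simp: small_def\<close>)
      moreover have "fits W s (Reg ''p'')" "fits W s (Reg ''e'')"
        by (rule fits_small[OF bnd[OF r]]; simp add: small_def)+
      moreover have "val s (Reg ''p'') < val s (Reg ''e'')"
        using J k by (simp add: J_def)
      ultimately show "fits W s (Reg ''p'') \<and> fits W s (Reg ''e'') \<and>
          val s (Reg ''p'') < val s (Reg ''e'') \<and>
          runs W (Seq (Assign ''p'' (Plus (Reg ''p'') (Num 1)))
         (Seq (Assign ''w'' (Mem (Reg ''p'')))
           (IfLess (Reg ''acc'') e1 (Assign ''acc'' e1) Skip))) s 2010 (J (Suc k))"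
        by blast
    next
      fix s assume J: "J (length l) s"
      then have "repr A s"
        by (simp add: J_def)
      then have "fits W s (Reg ''p'')" "fits W s (Reg ''e'')"
        by (auto intro!: fits_small[OF bnd] simp: small_def simp del: fits.simps)
      with J show "fits W s (Reg ''p'') \<and> fits W s (Reg ''e'') \<and>
          \<not> val s (Reg ''p'') < val s (Reg ''e'') \<and>
          repr A s \<and> fst s ''i'' = i \<and> fst s ''d'' = length l \<and> fst s ''p'' = pos i + length l \<and>
      fst s ''acc'' = Max (insert f0 (f1 ` set l))"
        by (simp add: J_def)
    qed simp
  qed (use small in \<open>simp add: small_def\<close>)
qed

lemma sum_degrees: "(\<Sum>i<n. Suc (length (ls ! i))) + 1 = len"
proof -
  have "(\<Sum>i<m. Suc (length (ls ! i))) + 1 = pos m" if "m \<le> n" for m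
    using that by (induction m) (simp_all add: pos_Suc)
  from this[of n] show ?thesis by simp
qed

text \<open>\<open>g i\<close> is the content of the target array after \<open>i\<close> vertices.
  Knowing it at every moment lets the expressions read the array that is being filled, as counting
  and summing require.\<close>

lemma runs_sweep:
  assumes s: "repr A s" and t: "t < 13" and A: "A t = g 0"
    and small: "small e0" "small e1" "small c1" "small c2" "small (cell t ix)" "small v"
    and e0: "\<And>i s. i < n \<Longrightarrow> repr (A(t := g i)) s \<Longrightarrow> fst s ''i'' = i \<Longrightarrow>
      fst s ''d'' = length (ls ! i) \<Longrightarrow> val s e0 = f0 i \<and> f0 i \<le> B"
    and e1: "\<And>i s w. i < n \<Longrightarrow> repr (A(t := g i)) s \<Longrightarrow> fst s ''i'' = i \<Longrightarrow>
      fst s ''d'' = length (ls ! i) \<Longrightarrow> w \<in> set (ls ! i) \<Longrightarrow> fst s ''w'' = w \<Longrightarrow>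
      val s e1 = f1 i w \<and> f1 i w \<le> B"
    and store: "\<And>i s. i < n \<Longrightarrow> repr (A(t := g i)) s \<Longrightarrow> fst s ''i'' = i \<Longrightarrow>
      fst s ''d'' = length (ls ! i) \<Longrightarrow>
      fst s ''acc'' = Max (insert (f0 i) (f1 i ` set (ls ! i))) \<Longrightarrow>
      if val s c1 < val s c2 then val s ix \<le> n \<and> val s v \<le> B \<and> (g i)(val s ix := val s v) = g (Suc i)
      else g (Suc i) = g i"
  shows "runs W (sweep e0 e1 c1 c2 t ix v) s (6000 * len) (repr (A(t := g n)))"
proof -
  define I where "I i s \<longleftrightarrow> repr (A(t := g i)) s \<and> fst s ''i'' = i \<and> fst s ''p'' = pos i" for i s
  let ?post = "Seq (IfLess c1 c2 (Write (cell t ix) v) Skip)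
         (Seq (Assign ''p'' (Plus (Reg ''p'') (Num 1)))
           (Assign ''i'' (Plus (Reg ''i'') (Num 1))))"
  let ?body = "Seq (Assign ''d'' (Mem (Reg ''p'')))
         (Seq (Assign ''e'' (Plus (Reg ''p'') (Reg ''d'')))
         (Seq (visit e0 e1) ?post))"
  have bnd: "bounded_state B s" if "repr A' s" for A' s
    using that by (simp add: repr_def)
  have fit: "fits W s e" if "repr A' s" "small e" for A' s e
    using that fits_small by (simp add: repr_def)
  have body: "runs W ?body s (5900 + 2020 * length (ls ! i)) (I (Suc i))"
    if i: "i < n" and I: "I i s" for i s
  proof -
    let ?l = "ls ! i" and ?A = "A(t := g i)"
    let ?s1 = "upd s ''d'' (length ?l)"
    let ?s2 = "upd ?s1 ''e'' (pos i + length ?l)"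
    have le: "pos i + length ?l < len"
      by (rule pos_degree_less[OF i])
    have r: "repr ?A s" and ip: "fst s ''i'' = i" "fst s ''p'' = pos i"
      using I by (simp_all add: I_def)
    have r1: "repr ?A ?s1"
      using r le B_bounds by (intro repr_upd) auto
    have r2: "repr ?A ?s2"
      using le B_bounds by (intro repr_upd[OF r1]) auto
    have deg: "snd s (pos i) = length ?l"
      using r le input_degree[OF i] by (simp add: repr_def)
    have post: "runs W ?post s 4020 (I (Suc i))"
      if q: "repr ?A s \<and> fst s ''i'' = i \<and> fst s ''d'' = length ?l \<and> fst s ''p'' = pos i + length ?l \<and>
        fst s ''acc'' = Max (insert (f0 i) (f1 i ` set ?l))" for s
    proof (rule runs_Seq)
      let ?P = "\<lambda>s. repr (A(t := g (Suc i))) s \<and> fst s ''i'' = i \<and> fst s ''p'' = pos i + length ?l"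
      have rs: "repr ?A s"
        using q by blast
      have st: "if val s c1 < val s c2 then val s ix \<le> n \<and> val s v \<le> B \<and>
          (g i)(val s ix := val s v) = g (Suc i) else g (Suc i) = g i"
        using store[OF i rs] q by blast
      show "runs W (IfLess c1 c2 (Write (cell t ix) v) Skip) s 4002 ?P"
      proof (rule runs_IfLess[where T = 2001])
        show "fits W s c1" "fits W s c2"
          using fit[OF rs] small by blast+
      next
        assume lt: "val s c1 < val s c2"
        show "runs W (Write (cell t ix) v) s 2001 ?P"
        proof (rule runs_Write)
          show "fits W s (cell t ix)" "fits W s v"
            using fit[OF rs] small by blast+
          have "repr (?A(t := (?A t)(val s ix := val s v)))
              (fst s, (snd s)(t * (n + 1) + (len + val s ix) := val s v))"
            using lt st t by (intro repr_write[OF rs]) auto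
          moreover have "?A(t := (?A t)(val s ix := val s v)) = A(t := g (Suc i))"
            using lt st by simp
          ultimately have "repr (A(t := g (Suc i))) (fst s, (snd s)(val s (cell t ix) := val s v))"
            by (simp only: val_cell[OF rs])
          then show "?P (fst s, (snd s)(val s (cell t ix) := val s v))"
            using q by simp
        qed (use small in \<open>simp add: small_def\<close>)
      next
        assume "\<not> val s c1 < val s c2"
        then show "runs W Skip s 2001 ?P"
          using st q by (intro runs_Skip) auto
      qed (use small in \<open>simp add: small_def\<close>)
      fix s assume P: "?P s"
      let ?s1 = "upd s ''p'' (pos (Suc i))"
      have "pos (Suc i) \<le> B" "Suc i \<le> B"
        using pos_Suc[OF i] le B_bounds i by simp_all
      then have r1: "repr (A(t := g (Suc i))) ?s1" and r2: "repr (A(t := g (Suc i))) (upd ?s1 ''i'' (Suc i))"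
        using P by (auto intro!: repr_upd)
      have "runs W (Assign ''i'' (Plus (Reg ''i'') (Num 1))) ?s1 4 (I (Suc i))"
        using P r2 by (intro runs_Assign fit[OF r1]) (auto simp: small_def I_def)
      then show "runs W (Seq (Assign ''p'' (Plus (Reg ''p'') (Num 1)))
           (Assign ''i'' (Plus (Reg ''i'') (Num 1)))) s 8 (I (Suc i))"
        by (rule runs_Assign_Seq_small[rotated 3])
          (use P pos_Suc[OF i] in \<open>auto simp: small_def repr_def\<close>)
    qed simp
    have "runs W (visit e0 e1) ?s2 (1010 + 2020 * length ?l)
      (\<lambda>s. repr ?A s \<and> fst s ''i'' = i \<and> fst s ''d'' = length ?l \<and> fst s ''p'' = pos i + length ?l \<and>
        fst s ''acc'' = Max (insert (f0 i) (f1 i ` set ?l)))"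
      by (rule runs_visit[OF i refl r2]) (use ip small e0[OF i r2] e1[OF i] in auto)
    then have "runs W (Seq (visit e0 e1) ?post) ?s2 (5040 + 2020 * length ?l) (I (Suc i))"
      by (rule runs_Seq[OF _ post]) (assumption | simp)+
    then have "runs W (Seq (Assign ''e'' (Plus (Reg ''p'') (Reg ''d'')))
         (Seq (visit e0 e1) ?post)) ?s1 (5100 + 2020 * length ?l) (I (Suc i))"
      by (rule runs_Assign_Seq_small[OF bnd[OF r1], rotated 2]) (use ip in \<open>auto simp: small_def\<close>)
    then show ?thesis
      by (rule runs_Assign_Seq_small[OF bnd[OF r], rotated 2]) (use ip deg in \<open>auto simp: small_def\<close>)
  qed
  \<comment> \<open>Vertex \<open>k\<close> is charged 6000 for each cell of its block, that is for
    its degree entry and its neighbours. The blocks fill the input except for its first cell, and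
    the 6000 units of that cell pay for the setup.\<close>
  have time: "(\<Sum>k<n. 5900 + 2020 * length (ls ! k) + 3) + 3 \<le> 6000 * len - 4"
  proof -
    have "(\<Sum>k<n. 5900 + 2020 * length (ls ! k) + 3) \<le> (\<Sum>k<n. 6000 * Suc (length (ls ! k)))"
      by (rule sum_mono) simp
    also have "\<dots> = 6000 * (len - 1)"
      by (simp only: sum_distrib_left[symmetric] sum_degrees[symmetric] diff_add_inverse2)
    finally show ?thesis
      using sum_degrees by simp
  qed
  let ?s1 = "upd s ''i'' 0"
  let ?s2 = "upd ?s1 ''p'' 1"
  have r1: "repr A ?s1"
    using s by (intro repr_upd) auto
  have r2: "repr A ?s2"
    using B_bounds by (intro repr_upd[OF r1]) auto
  have "runs W (WhileLess (Reg ''i'') (Reg ''n'') ?body) ?s2 (6000 * len - 4) (repr (A(t := g n)))"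
  proof (rule runs_WhileLess[where I = I and m = n])
    show "I 0 ?s2"
      using r2 A by (simp add: I_def fun_upd_idem)
    fix k s assume k: "k < n" and I: "I k s"
    then have "repr (A(t := g k)) s"
      by (simp add: I_def)
    then have "fits W s (Reg ''i'')" "fits W s (Reg ''n'')" "fst s ''n'' = n"
      by (auto intro!: fit[of "A(t := g k)"] simp: small_def repr_def simp del: fits.simps)
    then show "fits W s (Reg ''i'') \<and> fits W s (Reg ''n'') \<and> val s (Reg ''i'') < val s (Reg ''n'') \<and>
      runs W ?body s (5900 + 2020 * length (ls ! k)) (I (Suc k))"
      using body[OF k I] I k by (auto simp: I_def simp del: fits.simps)
  next
    fix s assume I: "I n s"
    then have "repr (A(t := g n)) s"
      by (simp add: I_def)
    then have "fits W s (Reg ''i'')" "fits W s (Reg ''n'')" "fst s ''n'' = n"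
      by (auto intro!: fit[of "A(t := g n)"] simp: small_def repr_def simp del: fits.simps)
    then show "fits W s (Reg ''i'') \<and> fits W s (Reg ''n'') \<and> \<not> val s (Reg ''i'') < val s (Reg ''n'') \<and>
      repr (A(t := g n)) s"
      using I by (auto simp: I_def simp del: fits.simps)
  qed (use time in simp)
  then have "runs W (Seq (Assign ''p'' (Num 1)) (WhileLess (Reg ''i'') (Reg ''n'') ?body)) ?s1
      (6000 * len - 2) (repr (A(t := g n)))"
    by (rule runs_Assign_Seq_small[OF bnd[OF r1], rotated 2])
      (use sum_degrees in \<open>auto simp: small_def\<close>)
  then show ?thesis
    unfolding sweep_def
    by (rule runs_Assign_Seq_small[OF bnd[OF s], rotated 2])
      (use sum_degrees in \<open>auto simp: small_def\<close>)
qed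

lemma runs_prepare: "runs W prepare (init_state input) (100 * len) (repr (\<lambda>_ _. 0))"
proof -
  let ?m = "\<lambda>i. if i < len then input ! i else 0"
  let ?s = "init_state input"
  have bm: "?m i \<le> B" for i
    using input_le by simp
  have fit: "fits W s e" if "bounded_state B s" "small e" for s e
    using fits_small that by blast
  define I where "I i s \<longleftrightarrow> bounded_state B s \<and> snd s = ?m \<and> fst s ''n'' = n \<and> fst s ''i'' = i \<and>
    fst s ''p'' = pos i" for i s
  have b0: "bounded_state B ?s"
    using bm by (simp add: bounded_state_def init_state_def)
  let ?s1 = "upd ?s ''n'' n"
  let ?s2 = "upd ?s1 ''p'' 1"
  have b1: "bounded_state B ?s1"
    by (rule bounded_upd[OF b0]) (rule B_bounds)
  have b2: "bounded_state B ?s2"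
    using B_bounds by (intro bounded_upd[OF b1]) simp
  let ?loop = "WhileLess (Reg ''i'') (Reg ''n'')
         (Seq (Assign ''p'' (Plus (Reg ''p'') (Plus (Num 1) (Mem (Reg ''p'')))))
           (Assign ''i'' (Plus (Reg ''i'') (Num 1))))"
  let ?fin = "Seq (Assign ''b'' (Reg ''p'')) (Assign ''st'' (Plus (Reg ''n'') (Num 1)))"
  have n_len: "n + 1 \<le> len"
  proof -
    have "(\<Sum>i<n. 1) \<le> (\<Sum>i<n. Suc (length (ls ! i)))"
      by (rule sum_mono) simp
    then show ?thesis
      using sum_degrees by simp
  qed
  have loop: "runs W ?loop ?s2 (30 * len) (I n)"
  proof (rule runs_WhileLess[where I = I and m = n and T = "\<lambda>_. 11"])
    show "I 0 ?s2"
      using b2 by (simp add: I_def init_state_def)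
    fix k s assume k: "k < n" and I: "I k s"
    then have b: "bounded_state B s"
      by (simp add: I_def)
    then have f: "fits W s (Reg ''i'')" "fits W s (Reg ''n'')"
      by (auto intro!: fit simp: small_def simp del: fits.simps)
    let ?t1 = "upd s ''p'' (pos (Suc k))"
    have pk: "pos (Suc k) \<le> B"
      using pos_Suc[OF k] pos_degree_less[OF k] B_bounds by simp
    have bt1: "bounded_state B ?t1"
      by (rule bounded_upd[OF b pk])
    have bt2: "bounded_state B (upd ?t1 ''i'' (Suc k))"
      using k B_bounds by (intro bounded_upd[OF bt1]) simp
    have "snd s (pos k) = length (ls ! k)"
      using I input_degree[OF k] pos_degree_less[OF k] by (simp add: I_def)
    moreover have "runs W (Assign ''i'' (Plus (Reg ''i'') (Num 1))) ?t1 4 (I (Suc k))"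
      using I bt2 by (intro runs_Assign fit[OF bt1]) (auto simp: small_def I_def)
    ultimately have "runs W (Seq (Assign ''p'' (Plus (Reg ''p'') (Plus (Num 1) (Mem (Reg ''p'')))))
           (Assign ''i'' (Plus (Reg ''i'') (Num 1)))) s 11 (I (Suc k))"
      using I pos_Suc[OF k] by (intro runs_Assign_Seq_small[OF b, of _ "pos (Suc k)"])
        (auto simp: small_def I_def)
    then show "fits W s (Reg ''i'') \<and> fits W s (Reg ''n'') \<and> val s (Reg ''i'') < val s (Reg ''n'') \<and>
        runs W (Seq (Assign ''p'' (Plus (Reg ''p'') (Plus (Num 1) (Mem (Reg ''p'')))))
           (Assign ''i'' (Plus (Reg ''i'') (Num 1)))) s 11 (I (Suc k))"
      using f I k by (simp add: I_def del: fits.simps)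
  next
    fix s assume I: "I n s"
    then have "bounded_state B s"
      by (simp add: I_def)
    then have "fits W s (Reg ''i'')" "fits W s (Reg ''n'')"
      by (auto intro!: fit simp: small_def simp del: fits.simps)
    with I show "fits W s (Reg ''i'') \<and> fits W s (Reg ''n'') \<and> \<not> val s (Reg ''i'') < val s (Reg ''n'') \<and> I n s"
      by (simp add: I_def del: fits.simps)
  qed (use n_len in simp)
  have fin: "runs W ?fin s 10 (repr (\<lambda>_ _. 0))" if I: "I n s" for s
  proof -
    have b: "bounded_state B s" and p: "fst s ''p'' = len" "fst s ''n'' = n"
      using I by (simp_all add: I_def)
    let ?t1 = "upd s ''b'' len"
    have bt1: "bounded_state B ?t1"
      by (rule bounded_upd[OF b]) (rule B_bounds)
    have bt2: "bounded_state B (upd ?t1 ''st'' (Suc n))"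
      using B_bounds by (intro bounded_upd[OF bt1]) simp
    have "repr (\<lambda>_ _. 0) (upd ?t1 ''st'' (Suc n))"
      using I bt2 by (auto simp: repr_def I_def)
    then have "runs W (Assign ''st'' (Plus (Reg ''n'') (Num 1))) ?t1 4 (repr (\<lambda>_ _. 0))"
      using p by (intro runs_Assign fit[OF bt1]) (auto simp: small_def)
    then show ?thesis
      by (rule runs_Assign_Seq_small[OF b, rotated 2]) (use p in \<open>auto simp: small_def\<close>)
  qed
  have "runs W (Seq ?loop ?fin) ?s2 (30 * len + 10) (repr (\<lambda>_ _. 0))"
    by (rule runs_Seq[OF loop fin]) auto
  then have "runs W (Seq (Assign ''p'' (Num 1)) (Seq ?loop ?fin)) ?s1 (30 * len + 12) (repr (\<lambda>_ _. 0))"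
    by (rule runs_Assign_Seq_small[OF b1, rotated 2]) (auto simp: small_def)
  moreover have "val ?s (Mem (Num 0)) = n"
    by (simp add: init_state_def input_def)
  ultimately show ?thesis
    unfolding prepare_def
    using n_len by (intro runs_Assign_Seq_small[OF b0, of _ n _ _ "30 * len + 12"])
      (simp_all add: small_def)
qed

end

section \<open>The hull number program\<close>

text \<open>Turns the maximum collected by \<open>visit\<close> into a test for the existence of a
  neighbour with some property.\<close>

lemma Max_indicator:
  assumes "finite S"
  shows "Max (insert (if P then 1 else 0) ((\<lambda>w. if Q w then 1 else (0::nat)) ` S)) =
    (if P \<or> (\<exists>w\<in>S. Q w) then 1 else (0::nat))"
proof (rule Max_eqI)
  fix y assume "y \<in> insert (if P then 1 else 0) ((\<lambda>w. if Q w then 1 else (0::nat)) ` S)"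
  then show "y \<le> (if P \<or> (\<exists>w\<in>S. Q w) then 1 else 0)"
    by (auto split: if_splits)
qed (use assms in \<open>auto simp: image_iff\<close>)

abbreviation vertex_reg :: expr where
  "vertex_reg \<equiv> Reg ''i''"

abbreviation number_expr :: expr where
  "number_expr \<equiv> Plus (Reg ''i'') (Num 1)"

abbreviation label_expr :: expr where
  "label_expr \<equiv> get 3 (Reg ''i'')"

text \<open>The guard leaves the entry of a deleted vertex at its initial 0, as the case distinction
  in \<open>pull\<close> demands.\<close>

definition pull_sweep :: "nat \<Rightarrow> nat \<Rightarrow> com" where
  "pull_sweep k t = sweep (get k (Reg ''i'')) (get k (Reg ''w'')) (Num 0) (get k (Reg ''i''))
     t (Reg ''i'') (Reg ''acc'')"

text \<open>The \<open>m\<close>-th program fills array \<open>m\<close>: numbers, three rounds of labels, component sizes,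
  numbers of universal vertices, numbers after their removal, three rounds of labels again,
  marks, flags, and in the first cell of the last array the sum of the weights. As the machine
  cannot multiply, the last expression subtracts three times the distance of label and number
  in order to vanish unless they agree.\<close>

definition stage_com :: "nat \<Rightarrow> com" where
  "stage_com m = [
     sweep (Num 0) (Num 0) (Num 0) (Num 1) 0 vertex_reg number_expr,
     pull_sweep 0 1,
     pull_sweep 1 2,
     pull_sweep 2 3,
     sweep (Num 0) (Num 0) (Num 0) (Num 1) 4 label_expr (Plus (get 4 label_expr) (Num 1)),
     sweep (Num 0) (Num 0) (Num 0) (eq_expr (Plus (Reg ''d'') (Num 1)) (get 4 label_expr))
       5 label_expr number_expr,
     sweep (Num 0) (Num 0) (eq_expr (get 5 label_expr) number_expr) (Num 1) 6 vertex_reg number_expr,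
     pull_sweep 6 7,
     pull_sweep 7 8,
     pull_sweep 8 9,
     sweep (Num 0) (eq_expr (Plus (Reg ''w'') (Num 1)) label_expr) (Num 0) (Num 1)
       10 vertex_reg (Reg ''acc''),
     sweep (eq_expr (Reg ''d'') (Num 1)) (eq_expr (get 10 (Reg ''w'')) (get 10 vertex_reg))
       (Num 0) (Reg ''acc'') 11 label_expr (Num 1),
     Seq
       (sweep (Num 0) (Num 0) (Num 0) (get 5 label_expr) 12 (Num 0)
         (Plus (get 12 (Num 0))
           (Plus (eq_expr (get 5 label_expr) number_expr) (eq_expr (get 9 vertex_reg) number_expr))))
       (sweep (Num 0) (Num 0) (get 5 label_expr) (Num 1) 12 (Num 0)
         (Plus (get 12 (Num 0))
           (Plus (eq_expr (Reg ''d'') (Num 1))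
             (Minus (Minus (Num 3) (get 11 label_expr)) (mul 3 (dist_expr label_expr number_expr))))))
     ] ! m"

fun stages :: "nat \<Rightarrow> com" where
  "stages 0 = prepare"
| "stages (Suc m) = Seq (stages m) (stage_com m)"

definition hull_number_com :: com where
  "hull_number_com = Seq (stages 13) (Assign ''out'' (get 12 (Num 0)))"

section \<open>Array contents in terms of the graph\<close>

locale encoded_graph = adjacency_input ls B W + p4_sparse_graph G
  for ls :: "nat list list" and B W :: nat and G :: "'a ugraph" +
  fixes vs :: "'a list"
  assumes vs: "distinct vs" "set vs = V" "length vs = n"
    and ls: "\<And>i. i < n \<Longrightarrow> distinct (ls ! i)"
      "\<And>i. i < n \<Longrightarrow> set (ls ! i) = {j. j < n \<and> adj (vs ! i) (vs ! j)}"
begin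

lemma vs_mem [simp]: "i < n \<Longrightarrow> vs ! i \<in> V"
  using vs by (metis nth_mem)

lemma vs_cases:
  assumes "v \<in> V"
  obtains i where "i < n" "v = vs ! i"
  using assms vs by (metis in_set_conv_nth)

lemma vs_eq_iff: "i < n \<Longrightarrow> j < n \<Longrightarrow> vs ! i = vs ! j \<longleftrightarrow> i = j"
  using vs by (simp add: nth_eq_iff_index_eq)

lemma bij_vs: "bij_betw ((!) vs) {..<n} V"
  using vs by (simp add: bij_betw_nth)

lemma neighbour_less: "i < n \<Longrightarrow> w \<in> set (ls ! i) \<Longrightarrow> w < n"
  using ls by blast

lemma image_neighbours:
  assumes i: "i < n"
  shows "(!) vs ` set (ls ! i) = nbrs (vs ! i)"
proof
  show "(!) vs ` set (ls ! i) \<subseteq> nbrs (vs ! i)"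
    using ls(2)[OF i] by blast
  show "nbrs (vs ! i) \<subseteq> (!) vs ` set (ls ! i)"
  proof
    fix y assume y: "y \<in> nbrs (vs ! i)"
    then have "y \<in> V"
      using adj_verts by blast
    then obtain j where "j < n" "y = vs ! j"
      by (rule vs_cases)
    with y show "y \<in> (!) vs ` set (ls ! i)"
      using ls(2)[OF i] by blast
  qed
qed

lemma card_neighbours:
  assumes "i < n"
  shows "card (nbrs (vs ! i)) = length (ls ! i)"
proof -
  have "inj_on ((!) vs) (set (ls ! i))"
    using neighbour_less[OF assms] by (auto simp: inj_on_def vs_eq_iff)
  then have "card (nbrs (vs ! i)) = card (set (ls ! i))"
    using image_neighbours[OF assms] card_image by metis
  then show ?thesis
    using ls(1)[OF assms] by (simp add: distinct_card)
qed

lemma ex_neighbour: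
  assumes "i < n"
  shows "(\<exists>w\<in>set (ls ! i). P (vs ! w)) \<longleftrightarrow> (\<exists>y. adj (vs ! i) y \<and> P y)"
proof -
  have "(\<exists>y\<in>nbrs (vs ! i). P y) \<longleftrightarrow> (\<exists>w\<in>set (ls ! i). P (vs ! w))"
    unfolding image_neighbours[OF assms, symmetric] by simp
  then show ?thesis by simp
qed

definition num :: "'a \<Rightarrow> nat" where
  "num v = (if v \<in> V then Suc (inv_into {..<n} ((!) vs) v) else 0)"

lemma num_vs [simp]: "i < n \<Longrightarrow> num (vs ! i) = Suc i"
  using bij_betw_inv_into_left[OF bij_vs, of i] by (simp add: num_def)

lemma num_le: "num v \<le> n"
proof (cases "v \<in> V")
  case True
  then obtain i where "i < n" "v = vs ! i"
    by (rule vs_cases)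
  then show ?thesis by simp
qed (simp add: num_def)

definition lb :: "'a \<Rightarrow> nat" where
  "lb = label G num"

definition univ_cond :: "nat \<Rightarrow> bool" where
  "univ_cond i \<longleftrightarrow> Suc (length (ls ! i)) = card {w \<in> V. lb w = lb (vs ! i)}"

text \<open>The state of the array during the sweep. A later universal vertex overwrites an earlier
  one of the same component, which the specification of \<open>univ\<close> permits.\<close>

primrec univ_upto :: "nat \<Rightarrow> nat \<Rightarrow> nat" where
  "univ_upto 0 = (\<lambda>_. 0)"
| "univ_upto (Suc i) = (if univ_cond i then (univ_upto i)(lb (vs ! i) := Suc i) else univ_upto i)"

lemma univ_upto:
  "(univ_upto m k = 0 \<and> \<not> (\<exists>j<m. lb (vs ! j) = k \<and> univ_cond j)) \<or>
   (\<exists>j<m. lb (vs ! j) = k \<and> univ_cond j \<and> univ_upto m k = Suc j)"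
proof (induction m)
  case (Suc m)
  then show ?case
    by (auto simp: less_Suc_eq)
qed simp

sublocale numbered_p4_sparse_graph G num "univ_upto n"
proof
  show "inj_on num V"
    by (rule inj_onI) (metis vs_cases num_vs nat.inject)
  show "0 < num v \<longleftrightarrow> v \<in> V" for v
    by (simp add: num_def)
  fix k
  have "(\<exists>v\<in>V. P v) \<longleftrightarrow> (\<exists>j<n. P (vs ! j))" for P
    by (metis vs_cases vs_mem)
  then show "(univ_upto n k = 0 \<and>
        \<not> (\<exists>v\<in>V. label G num v = k \<and> card (nbrs v) + 1 = card {w \<in> V. label G num w = label G num v})) \<or>
      (\<exists>v\<in>V. label G num v = k \<and> card (nbrs v) + 1 = card {w \<in> V. label G num w = label G num v} \<and>
        univ_upto n k = num v)"
    using univ_upto[of n k] by (auto simp: card_neighbours univ_cond_def lb_def)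
qed

lemma lb_lab: "lb = lab"
  by (simp add: lb_def)

definition tab :: "('a \<Rightarrow> nat) \<Rightarrow> nat \<Rightarrow> nat" where
  "tab f j = (if j < n then f (vs ! j) else 0)"

definition stage :: "nat \<Rightarrow> nat \<Rightarrow> nat" where
  "stage m = [
     tab num,
     tab (pull G num),
     tab (pull G (pull G num)),
     tab lab,
     \<lambda>k. card {v \<in> V. lab v = k},
     univ_upto n,
     tab num',
     tab (pull G num'),
     tab (pull G (pull G num')),
     tab lab',
     tab (\<lambda>v. if marked v then 1 else 0),
     flag,
     (\<lambda>_. 0)(0 := \<Sum>v\<in>V. weight v)] ! m"

definition arrays :: "nat \<Rightarrow> nat \<Rightarrow> nat \<Rightarrow> nat" where
  "arrays m = (\<lambda>k. if k < m then stage k else (\<lambda>_. 0))"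

lemma arrays_Suc: "(arrays m)(m := stage m) = arrays (Suc m)"
  by (auto simp: arrays_def)

lemma pull_le:
  assumes "\<And>v. f v \<le> m"
  shows "pull G f v \<le> m"
proof (cases "f v = 0")
  case False
  then obtain w where "pull G f v = f w"
    using pull_attained[of f v] by blast
  then show ?thesis
    using assms by simp
qed (simp add: pull_def)

lemma label_le: "(\<And>v. f v \<le> m) \<Longrightarrow> label G f v \<le> m"
  unfolding label_def by (intro pull_le)

lemma lab_le: "lab v \<le> n"
  by (intro label_le num_le)

lemma num'_le: "num' v \<le> n"
  using num_le by (simp add: num'_def)

text \<open>The instance of \<open>runs_sweep\<close> in which each vertex writes its own entry;
  skipping the store is right where the wanted value is the initial 0.\<close>

lemma runs_tabulate:
  assumes s: "repr A s" and t: "t < 13" and A: "A t = (\<lambda>_. 0)"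
    and small: "small e0" "small e1" "small c1" "small c2" "small v"
    and e0: "\<And>i s. i < n \<Longrightarrow> repr (A(t := \<lambda>j. if j < i then h (vs ! j) else 0)) s \<Longrightarrow> fst s ''i'' = i \<Longrightarrow>
      fst s ''d'' = length (ls ! i) \<Longrightarrow> val s e0 = f0 i \<and> f0 i \<le> B"
    and e1: "\<And>i s w. i < n \<Longrightarrow> repr (A(t := \<lambda>j. if j < i then h (vs ! j) else 0)) s \<Longrightarrow> fst s ''i'' = i \<Longrightarrow>
      fst s ''d'' = length (ls ! i) \<Longrightarrow> w \<in> set (ls ! i) \<Longrightarrow> fst s ''w'' = w \<Longrightarrow>
      val s e1 = f1 i w \<and> f1 i w \<le> B"
    and store: "\<And>i s. i < n \<Longrightarrow> repr (A(t := \<lambda>j. if j < i then h (vs ! j) else 0)) s \<Longrightarrow> fst s ''i'' = i \<Longrightarrow>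
      fst s ''d'' = length (ls ! i) \<Longrightarrow>
      fst s ''acc'' = Max (insert (f0 i) (f1 i ` set (ls ! i))) \<Longrightarrow>
      if val s c1 < val s c2 then val s v = h (vs ! i) \<and> h (vs ! i) \<le> B else h (vs ! i) = 0"
  shows "runs W (sweep e0 e1 c1 c2 t vertex_reg v) s (6000 * len) (repr (A(t := tab h)))"
proof -
  let ?g = "\<lambda>i j. if j < i then h (vs ! j) else 0"
  have "runs W (sweep e0 e1 c1 c2 t vertex_reg v) s (6000 * len) (repr (A(t := ?g n)))"
  proof (rule runs_sweep[where g = ?g and ?f0.0 = f0 and ?f1.0 = f1, OF s t], goal_cases)
    case 6
    then show ?case
      using t by (simp add: small_def)
  next
    case (8 i s)
    then show ?case
      by (rule e0)
  next
    case (9 i s w)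
    then show ?case
      by (rule e1)
  next
    case (10 i s)
    note st = store[OF 10]
    show ?case
    proof (cases "val s c1 < val s c2")
      case True
      then have "val s v = h (vs ! i)" "h (vs ! i) \<le> B"
        using st by simp_all
      moreover have "(?g i)(i := h (vs ! i)) = ?g (Suc i)"
        by (auto simp: fun_eq_iff)
      ultimately show ?thesis
        using True 10(1,3) by simp
    next
      case False
      then have "h (vs ! i) = 0"
        using st by simp
      then have "?g (Suc i) = ?g i"
        by (auto simp: fun_eq_iff less_Suc_eq)
      then show ?thesis
        using False by simp
    qed
  qed (use A small in auto)
  moreover have "?g n = tab h"
    by (auto simp: tab_def)
  ultimately show ?thesis by simp
qed

lemma runs_pull_sweep:
  assumes s: "repr A s" and kt: "k < 13" "t < 13" "k \<noteq> t" and A: "A t = (\<lambda>_. 0)" "A k = tab f"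
    and f: "\<And>v. f v \<le> n"
  shows "runs W (pull_sweep k t) s (6000 * len) (repr (A(t := tab (pull G f))))"
proof -
  have get: "val s (get k e) = f (vs ! val s e)" if "repr (A(t := g)) s" "val s e < n" for s e g
    using val_get[OF that(1) kt(1)] that(2) kt A by (simp add: tab_def)
  have fB: "f v \<le> B" for v
    using f[of v] B_bounds by simp
  show ?thesis
    unfolding pull_sweep_def
  proof (rule runs_tabulate[OF s kt(2) A(1), where ?f0.0 = "\<lambda>i. f (vs ! i)" and ?f1.0 = "\<lambda>_ w. f (vs ! w)"],
      goal_cases)
    case (7 i s w)
    then show ?case
      using get[OF 7(2)] neighbour_less fB by simp
  next
    case (8 i s)
    have "(\<lambda>w. f (vs ! w)) ` set (ls ! i) = f ` nbrs (vs ! i)"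
      using image_neighbours[OF 8(1)] by (metis image_image)
    then have "fst s ''acc'' = Max (insert (f (vs ! i)) (f ` nbrs (vs ! i)))"
      using 8(5) by simp
    then have "0 < f (vs ! i) \<Longrightarrow> fst s ''acc'' = pull G f (vs ! i)"
      by (simp add: pull_def)
    moreover have "pull G f (vs ! i) \<le> B"
      using pull_le[of f n "vs ! i"] f B_bounds by simp
    moreover have "val s (get k vertex_reg) = f (vs ! i)"
      using get[OF 8(2)] 8 by simp
    ultimately show ?case
      by simp
  qed (use kt get fB in \<open>auto simp: small_def\<close>)
qed

lemma runs_stage_pull:
  assumes "repr (arrays m) s" and "m < 13" "k < m" and "stage k = tab f" "stage m = tab (pull G f)"
    and "\<And>v. f v \<le> n"
  shows "runs W (pull_sweep k m) s (6000 * len) (repr (arrays (Suc m)))"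
proof -
  have "runs W (pull_sweep k m) s (6000 * len) (repr ((arrays m)(m := tab (pull G f))))"
    using assms by (intro runs_pull_sweep) (auto simp: arrays_def)
  then show ?thesis
    using arrays_Suc[of m] assms(5) by simp
qed

end

context encoded_graph
begin

lemma val_get_stage:
  assumes "repr ((arrays m)(m := g)) s" "m < 13"
  shows "k < m \<Longrightarrow> val s e \<le> n \<Longrightarrow> val s (get k e) = stage k (val s e)"
    and "val s e \<le> n \<Longrightarrow> val s (get m e) = g (val s e)"
  using val_get[OF assms(1), of k e] val_get[OF assms(1), of m e] assms(2) by (auto simp: arrays_def)

lemma val_label:
  assumes "repr ((arrays m)(m := g)) s" "3 < m" "m < 13" "fst s ''i'' = i" "i < n"
  shows "val s label_expr = lab (vs ! i)"
  using val_get_stage(1)[OF assms(1,3), of 3 "Reg ''i''"] assms by (simp add: stage_def tab_def)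

lemma ex_vertex: "(\<exists>v\<in>V. P v) \<longleftrightarrow> (\<exists>j<n. P (vs ! j))"
  by (metis vs_cases vs_mem)

section \<open>Correctness of the stages\<close>

lemma runs_stage_0:
  assumes "repr (arrays 0) s"
  shows "runs W (stage_com 0) s (6000 * len) (repr (arrays (Suc 0)))"
proof -
  have "runs W (sweep (Num 0) (Num 0) (Num 0) (Num 1) 0 vertex_reg number_expr) s (6000 * len)
      (repr ((arrays 0)(0 := tab num)))"
    by (rule runs_tabulate[where ?f0.0 = "\<lambda>_. 0" and ?f1.0 = "\<lambda>_ _. 0", OF assms])
      (use B_bounds in \<open>auto simp: small_def arrays_def\<close>)
  then show ?thesis
    using arrays_Suc[of 0] by (simp add: stage_com_def stage_def)
qed

lemma runs_stage_labels:
  assumes "repr (arrays m) s" "m \<in> {1, 2, 3, 7, 8, 9}"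
  shows "runs W (stage_com m) s (6000 * len) (repr (arrays (Suc m)))"
proof -
  have le: "num v \<le> n" "pull G num v \<le> n" "pull G (pull G num) v \<le> n"
    "num' v \<le> n" "pull G num' v \<le> n" "pull G (pull G num') v \<le> n" for v
    by (intro pull_le num_le num'_le)+
  consider "m = 1" | "m = 2" | "m = 3" | "m = 7" | "m = 8" | "m = 9"
    using assms(2) by blast
  then show ?thesis
  proof cases
    case 1
    then show ?thesis
      using runs_stage_pull[OF assms(1), of 0 num] le by (simp add: stage_com_def stage_def)
  next
    case 2
    then show ?thesis
      using runs_stage_pull[OF assms(1), of 1 "pull G num"] le by (simp add: stage_com_def stage_def)
  next
    case 3
    then show ?thesis
      using runs_stage_pull[OF assms(1), of 2 "pull G (pull G num)"] le
      by (simp add: stage_com_def stage_def label_def)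
  next
    case 4
    then show ?thesis
      using runs_stage_pull[OF assms(1), of 6 num'] le by (simp add: stage_com_def stage_def)
  next
    case 5
    then show ?thesis
      using runs_stage_pull[OF assms(1), of 7 "pull G num'"] le by (simp add: stage_com_def stage_def)
  next
    case 6
    then show ?thesis
      using runs_stage_pull[OF assms(1), of 8 "pull G (pull G num')"] le
      by (simp add: stage_com_def stage_def label_def)
  qed
qed

lemma runs_stage_4:
  assumes "repr (arrays 4) s"
  shows "runs W (stage_com 4) s (6000 * len) (repr (arrays (Suc 4)))"
proof -
  let ?g = "\<lambda>i k. card {j. j < i \<and> lab (vs ! j) = k}"
  have "runs W (sweep (Num 0) (Num 0) (Num 0) (Num 1) 4 label_expr (Plus (get 4 label_expr) (Num 1)))
      s (6000 * len) (repr ((arrays 4)(4 := ?g n)))"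
  proof (rule runs_sweep[where g = ?g and ?f0.0 = "\<lambda>_. 0" and ?f1.0 = "\<lambda>_ _. 0", OF assms], goal_cases)
    case (11 i s)
    have l: "val s label_expr = lab (vs ! i)"
      by (rule val_label[OF 11(2) _ _ 11(3,1)]) simp_all
    then have v: "val s (get 4 label_expr) = ?g i (lab (vs ! i))"
      using val_get_stage(2)[OF 11(2), of label_expr] lab_le by simp
    have "?g i (lab (vs ! i)) \<le> card {..<i}"
      by (rule card_mono) auto
    then have B: "?g i (lab (vs ! i)) + 1 \<le> B"
      using 11(1) B_bounds by simp
    have "?g (Suc i) k = ((?g i)(lab (vs ! i) := ?g i (lab (vs ! i)) + 1)) k" for k
    proof (cases "lab (vs ! i) = k")
      case True
      then have "{j. j < Suc i \<and> lab (vs ! j) = k} = insert i {j. j < i \<and> lab (vs ! j) = k}"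
        by (auto simp: less_Suc_eq)
      then show ?thesis
        using True by simp
    next
      case False
      then have "{j. j < Suc i \<and> lab (vs ! j) = k} = {j. j < i \<and> lab (vs ! j) = k}"
        by (auto simp: less_Suc_eq)
      then show ?thesis
        using False by simp
    qed
    then have "(?g i)(lab (vs ! i) := ?g i (lab (vs ! i)) + 1) = ?g (Suc i)"
      by auto
    then show ?case
      using l v B lab_le by simp
  qed (auto simp: small_def arrays_def)
  moreover have "?g n = stage 4"
  proof
    fix k
    have "{v \<in> V. lab v = k} = (!) vs ` {j. j < n \<and> lab (vs ! j) = k}"
      by (auto elim: vs_cases)
    moreover have "inj_on ((!) vs) {j. j < n \<and> lab (vs ! j) = k}"
      by (auto simp: inj_on_def vs_eq_iff)
    ultimately show "?g n k = stage 4 k"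
      by (simp add: stage_def card_image)
  qed
  ultimately show ?thesis
    using arrays_Suc[of 4] by (simp add: stage_com_def)
qed

lemma runs_stage_5:
  assumes "repr (arrays 5) s"
  shows "runs W (stage_com 5) s (6000 * len) (repr (arrays (Suc 5)))"
proof -
  have "runs W (sweep (Num 0) (Num 0) (Num 0) (eq_expr (Plus (Reg ''d'') (Num 1)) (get 4 label_expr))
       5 label_expr number_expr) s (6000 * len) (repr ((arrays 5)(5 := univ_upto n)))"
  proof (rule runs_sweep[where g = univ_upto and ?f0.0 = "\<lambda>_. 0" and ?f1.0 = "\<lambda>_ _. 0", OF assms],
      goal_cases)
    case (11 i s)
    have l: "val s label_expr = lab (vs ! i)"
      by (rule val_label[OF 11(2) _ _ 11(3,1)]) simp_all
    then have "val s (get 4 label_expr) = card {w \<in> V. lab w = lab (vs ! i)}"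
      using val_get_stage(1)[OF 11(2), of 4 label_expr] lab_le by (simp add: stage_def)
    then show ?case
      using 11 l lab_le B_bounds by (auto simp: univ_cond_def lb_lab)
  qed (auto simp: small_def arrays_def)
  then show ?thesis
    using arrays_Suc[of 5] by (simp add: stage_com_def stage_def)
qed

lemma runs_stage_6:
  assumes "repr (arrays 6) s"
  shows "runs W (stage_com 6) s (6000 * len) (repr (arrays (Suc 6)))"
proof -
  have "runs W (sweep (Num 0) (Num 0) (eq_expr (get 5 label_expr) number_expr) (Num 1)
      6 vertex_reg number_expr) s (6000 * len) (repr ((arrays 6)(6 := tab num')))"
  proof (rule runs_tabulate[where ?f0.0 = "\<lambda>_. 0" and ?f1.0 = "\<lambda>_ _. 0", OF assms], goal_cases)
    case (10 i s)
    have l: "val s label_expr = lab (vs ! i)"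
      by (rule val_label[OF 10(2) _ _ 10(3,1)]) simp_all
    then have "val s (get 5 label_expr) = univ_upto n (lab (vs ! i))"
      using val_get_stage(1)[OF 10(2), of 5 label_expr] lab_le by (simp add: stage_def)
    then show ?case
      using 10 B_bounds by (auto simp: num'_def)
  qed (auto simp: small_def arrays_def)
  then show ?thesis
    using arrays_Suc[of 6] by (simp add: stage_com_def stage_def)
qed

lemma runs_stage_10:
  assumes "repr (arrays 10) s"
  shows "runs W (stage_com 10) s (6000 * len) (repr (arrays (Suc 10)))"
proof -
  let ?h = "\<lambda>v. if marked v then 1 else (0::nat)"
  let ?f1 = "\<lambda>i w. if Suc w = lab (vs ! i) then 1 else (0::nat)"
  have "runs W (sweep (Num 0) (eq_expr (Plus (Reg ''w'') (Num 1)) label_expr) (Num 0) (Num 1)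
       10 vertex_reg (Reg ''acc'')) s (6000 * len) (repr ((arrays 10)(10 := tab ?h)))"
  proof (rule runs_tabulate[where ?f0.0 = "\<lambda>_. 0" and ?f1.0 = ?f1, OF assms], goal_cases)
    case (9 i s w)
    have "val s label_expr = lab (vs ! i)"
      by (rule val_label[OF 9(2) _ _ 9(3,1)]) simp_all
    then show ?case
      using 9 B_bounds by simp
  next
    case (10 i s)
    have "fst s ''acc'' = (if \<exists>w\<in>set (ls ! i). Suc w = lab (vs ! i) then 1 else 0)"
      using 10(5) Max_indicator[of "set (ls ! i)" False "\<lambda>w. Suc w = lab (vs ! i)"] by simp
    \<comment> \<open>Indices start at 0 and numbers at 1, so the program compares
      \<open>Suc w\<close> with the label.\<close>
    also have "(\<exists>w\<in>set (ls ! i). Suc w = lab (vs ! i)) \<longleftrightarrow> (\<exists>w\<in>set (ls ! i). num (vs ! w) = lab (vs ! i))"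
      using neighbour_less[OF 10(1)] by (intro bex_cong) auto
    also have "\<dots> \<longleftrightarrow> marked (vs ! i)"
      unfolding marked_def by (rule ex_neighbour[OF 10(1)])
    finally show ?case
      using B_bounds by simp
  qed (auto simp: small_def arrays_def)
  then show ?thesis
    using arrays_Suc[of 10] by (simp add: stage_com_def stage_def)
qed

lemma runs_stage_11:
  assumes "repr (arrays 11) s"
  shows "runs W (stage_com 11) s (6000 * len) (repr (arrays (Suc 11)))"
proof -
  let ?c = "\<lambda>v. card (nbrs v) = 1 \<or> (\<exists>w. adj v w \<and> marked w = marked v)"
  let ?g = "\<lambda>i k. if \<exists>j<i. lab (vs ! j) = k \<and> ?c (vs ! j) then 1 else (0::nat)"
  let ?f0 = "\<lambda>i. if length (ls ! i) = 1 then 1 else (0::nat)"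
  let ?f1 = "\<lambda>i w. if marked (vs ! w) = marked (vs ! i) then 1 else (0::nat)"
  have "runs W (sweep (eq_expr (Reg ''d'') (Num 1)) (eq_expr (get 10 (Reg ''w'')) (get 10 vertex_reg))
       (Num 0) (Reg ''acc'') 11 label_expr (Num 1)) s (6000 * len) (repr ((arrays 11)(11 := ?g n)))"
  proof (rule runs_sweep[where g = ?g and ?f0.0 = ?f0 and ?f1.0 = ?f1, OF assms], goal_cases)
    case (9 i s)
    then show ?case
      using B_bounds by simp
  next
    case (10 i s w)
    have "w < n"
      using neighbour_less 10 by blast
    then have "val s (get 10 (Reg ''w'')) = (if marked (vs ! w) then 1 else 0)"
      "val s (get 10 (Reg ''i'')) = (if marked (vs ! i) then 1 else 0)"
      using val_get_stage(1)[OF 10(2), of 10 "Reg ''w''"]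
        val_get_stage(1)[OF 10(2), of 10 "Reg ''i''"] 10 by (simp_all add: stage_def tab_def)
    then show ?case
      using B_bounds by simp
  next
    case (11 i s)
    have l: "val s label_expr = lab (vs ! i)"
      by (rule val_label[OF 11(2) _ _ 11(3,1)]) simp_all
    have "fst s ''acc'' = (if length (ls ! i) = 1 \<or> (\<exists>w\<in>set (ls ! i). marked (vs ! w) = marked (vs ! i))
        then 1 else 0)"
      unfolding 11(5) by (rule Max_indicator) simp
    also have "(length (ls ! i) = 1 \<or> (\<exists>w\<in>set (ls ! i). marked (vs ! w) = marked (vs ! i))) \<longleftrightarrow> ?c (vs ! i)"
      using ex_neighbour[OF 11(1), of "\<lambda>w. marked w = marked (vs ! i)"] card_neighbours[OF 11(1)] by simp
    finally have acc: "fst s ''acc'' = (if ?c (vs ! i) then 1 else 0)" .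
    show ?case
    proof (cases "?c (vs ! i)")
      case True
      have "(?g i)(lab (vs ! i) := 1) = ?g (Suc i)"
        using True by (auto simp: fun_eq_iff less_Suc_eq)
      then show ?thesis
        using True acc l lab_le B_bounds by simp
    next
      case False
      then have "?g (Suc i) = ?g i"
        by (auto simp: fun_eq_iff less_Suc_eq)
      moreover have "fst s ''acc'' = 0"
        by (rule trans[OF acc if_not_P[OF False]])
      ultimately show ?thesis
        by simp
    qed
  qed (auto simp: small_def arrays_def)
  moreover have "?g n = stage 11"
    by (auto simp: fun_eq_iff stage_def flag_def ex_vertex)
  ultimately show ?thesis
    using arrays_Suc[of 11] by (simp add: stage_com_def)
qed

text \<open>The 4 allows 1 for a leaf plus at most 3 for a representative. Two accumulating sweeps
  reach at most \<open>8 * n\<close>, which is within \<open>B\<close>.\<close>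

lemma runs_accumulate:
  assumes s: "repr ((arrays 12)(12 := (\<lambda>_. 0)(0 := a))) s"
    and small: "small c1" "small c2" "small (Plus (get 12 (Num 0)) x)"
    and h: "\<And>i. h i \<le> 4" "a \<le> 4 * n"
    and x: "\<And>i s g. i < n \<Longrightarrow> repr ((arrays 12)(12 := g)) s \<Longrightarrow> fst s ''i'' = i \<Longrightarrow>
      fst s ''d'' = length (ls ! i) \<Longrightarrow> if val s c1 < val s c2 then val s x = h i else h i = 0"
  shows "runs W (sweep (Num 0) (Num 0) c1 c2 12 (Num 0) (Plus (get 12 (Num 0)) x)) s (6000 * len)
    (repr ((arrays 12)(12 := (\<lambda>_. 0)(0 := a + (\<Sum>i<n. h i)))))"
proof -
  let ?A = "(arrays 12)(12 := (\<lambda>_. 0)(0 := a))"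
  let ?g = "\<lambda>i. (\<lambda>_. 0)(0 := a + (\<Sum>j<i. h j))"
  have "runs W (sweep (Num 0) (Num 0) c1 c2 12 (Num 0) (Plus (get 12 (Num 0)) x)) s (6000 * len)
    (repr (?A(12 := ?g n)))"
  proof (rule runs_sweep[where g = ?g and ?f0.0 = "\<lambda>_. 0" and ?f1.0 = "\<lambda>_ _. 0", OF s], goal_cases)
    case (11 i s)
    then have r: "repr ((arrays 12)(12 := ?g i)) s"
      by simp
    have x: "if val s c1 < val s c2 then val s x = h i else h i = 0"
      using x[OF 11(1) r 11(3,4)] .
    have v: "val s (get 12 (Num 0)) = a + (\<Sum>j<i. h j)"
      using val_get_stage(2)[OF r, of "Num 0"] by simp
    have "(\<Sum>j<i. h j) + h i \<le> 4 * n"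
    proof -
      have "(\<Sum>j<Suc i. h j) \<le> (\<Sum>j<Suc i. 4)"
        by (rule sum_mono) (rule h)
      then show ?thesis
        using 11(1) by simp
    qed
    then have "a + (\<Sum>j<i. h j) + h i \<le> B"
      using h(2) B_bounds by simp
    then show ?case
      using x v by (auto simp: add.assoc)
  qed (use small in \<open>auto simp: small_def\<close>)
  then show ?thesis by simp
qed

text \<open>A sweep has a single conditional store, so each of the two cases of
  \<open>weight\<close> gets a sweep of its own. \<open>?h1\<close> and \<open>?h2\<close> vanish
  outside their case and add up to the weight.\<close>

lemma runs_stage_12:
  assumes "repr (arrays 12) s"
  shows "runs W (stage_com 12) s (12000 * len) (repr (arrays (Suc 12)))"
proof -
  let ?u = "\<lambda>i. univ_upto n (lab (vs ! i))"
  let ?h1 = "\<lambda>i. if 0 < ?u i then (if ?u i = Suc i then 1 else 0) +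
    (if lab' (vs ! i) = Suc i then 1 else 0) else (0::nat)"
  let ?h2 = "\<lambda>i. if 0 < ?u i then 0 else (if length (ls ! i) = 1 then 1 else 0) +
    (if lab (vs ! i) = Suc i then 3 - flag (lab (vs ! i)) else 0)"
  have vals: "val s label_expr = lab (vs ! i)" "val s (get 5 label_expr) = ?u i"
    "val s (get 9 vertex_reg) = lab' (vs ! i)" "val s (get 11 label_expr) = flag (lab (vs ! i))"
    if "repr ((arrays 12)(12 := g)) s" "fst s ''i'' = i" "i < n" for s i g
  proof -
    show l: "val s label_expr = lab (vs ! i)"
      by (rule val_label[OF that(1) _ _ that(2,3)]) simp_all
    show "val s (get 5 label_expr) = ?u i"
      using val_get_stage(1)[OF that(1), of 5 label_expr] l lab_le by (simp add: stage_def)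
    show "val s (get 9 vertex_reg) = lab' (vs ! i)"
      using val_get_stage(1)[OF that(1), of 9 vertex_reg] that by (simp add: stage_def tab_def)
    show "val s (get 11 label_expr) = flag (lab (vs ! i))"
      using val_get_stage(1)[OF that(1), of 11 label_expr] l lab_le by (simp add: stage_def)
  qed
  have A: "arrays 12 = (arrays 12)(12 := (\<lambda>_. 0)(0 := 0))"
    by (auto simp: arrays_def fun_eq_iff)
  have 1: "runs W (sweep (Num 0) (Num 0) (Num 0) (get 5 label_expr) 12 (Num 0)
         (Plus (get 12 (Num 0))
           (Plus (eq_expr (get 5 label_expr) number_expr) (eq_expr (get 9 vertex_reg) number_expr))))
       s (6000 * len) (repr ((arrays 12)(12 := (\<lambda>_. 0)(0 := 0 + (\<Sum>i<n. ?h1 i)))))"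
  proof (rule runs_accumulate, goal_cases)
    case 1
    then show ?case
      using assms A by simp
  next
    case (7 i s g)
    then show ?case
      using vals[OF 7(2,3,1)] by simp
  qed (auto simp: small_def)
  have le: "(\<Sum>i<n. ?h1 i) \<le> 4 * n"
  proof -
    have "(\<Sum>i<n. ?h1 i) \<le> (\<Sum>i<n. 4)"
      by (rule sum_mono) auto
    then show ?thesis by simp
  qed
  have 2: "runs W (sweep (Num 0) (Num 0) (get 5 label_expr) (Num 1) 12 (Num 0)
         (Plus (get 12 (Num 0))
           (Plus (eq_expr (Reg ''d'') (Num 1))
             (Minus (Minus (Num 3) (get 11 label_expr)) (mul 3 (dist_expr label_expr number_expr))))))
       s (6000 * len) (repr ((arrays 12)(12 := (\<lambda>_. 0)(0 := (\<Sum>i<n. ?h1 i) + (\<Sum>i<n. ?h2 i)))))"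
    if "repr ((arrays 12)(12 := (\<lambda>_. 0)(0 := 0 + (\<Sum>i<n. ?h1 i)))) s" for s
  proof (rule runs_accumulate, goal_cases)
    case 1
    then show ?case
      using that by simp
  next
    case 6
    then show ?case
      by (rule le)
  next
    case (7 i s g)
    then show ?case
      using vals[OF 7(2,3,1)] by auto
  qed (auto simp: small_def)
  have "(\<Sum>i<n. ?h1 i) + (\<Sum>i<n. ?h2 i) = (\<Sum>i<n. weight (vs ! i))"
    unfolding sum.distrib[symmetric]
    by (rule sum.cong) (auto simp: weight_def card_neighbours)
  also have "\<dots> = (\<Sum>v\<in>V. weight v)"
    by (rule sum.reindex_bij_betw[OF bij_vs])
  finally have "(\<lambda>_. 0)(0 := (\<Sum>i<n. ?h1 i) + (\<Sum>i<n. ?h2 i)) = stage 12"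
    by (simp add: stage_def)
  then show ?thesis
    using runs_Seq[OF 1 2, of "12000 * len"] arrays_Suc[of 12] by (simp add: stage_com_def)
qed

text \<open>Every stage is charged like the last one, which consists of two sweeps.\<close>

lemma runs_stages: "m \<le> 13 \<Longrightarrow> runs W (stages m) (init_state input) ((100 + m * 12000) * len) (repr (arrays m))"
proof (induction m)
  case 0
  then show ?case
    using runs_prepare by (simp add: arrays_def)
next
  case (Suc m)
  have weaken: "runs W c s T Q" if "runs W c s T' Q" "T' \<le> T" for c s T' T Q
    using that unfolding runs_def by (meson le_trans)
  have "runs W (stage_com m) s (12000 * len) (repr (arrays (Suc m)))" if s: "repr (arrays m) s" for s
  proof -
    consider "m = 0" | "m \<in> {1, 2, 3, 7, 8, 9}" | "m = 4" | "m = 5" | "m = 6" | "m = 10" | "m = 11" | "m = 12"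
    proof -
      have "m = 0 \<or> m = 1 \<or> m = 2 \<or> m = 3 \<or> m = 4 \<or> m = 5 \<or> m = 6 \<or> m = 7 \<or> m = 8 \<or> m = 9 \<or>
          m = 10 \<or> m = 11 \<or> m = 12"
        using Suc.prems by presburger
      then show thesis
        using that by blast
    qed
    then have "runs W (stage_com m) s (6000 * len) (repr (arrays (Suc m))) \<or>
        runs W (stage_com m) s (12000 * len) (repr (arrays (Suc m)))"
      using runs_stage_0 runs_stage_labels runs_stage_4 runs_stage_5 runs_stage_6 runs_stage_10
        runs_stage_11 runs_stage_12 s
      by cases blast+
    then show ?thesis
      using weaken[of "stage_com m" s "6000 * len"] by auto
  qed
  then show ?case
    using Suc by (simp, intro runs_Seq[OF Suc.IH]) (auto simp: algebra_simps)
qed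

lemma runs_hull_number_com:
  "runs W hull_number_com (init_state input) (200000 * len) (\<lambda>s. fst s ''out'' = hn_cc G)"
  unfolding hull_number_com_def
proof (rule runs_Seq[OF runs_stages])
  fix s assume s: "repr (arrays 13) s"
  have "val s (get 12 (Num 0)) = arrays 13 12 0"
    using val_get[OF s, of 12 "Num 0"] by simp
  then have v: "val s (get 12 (Num 0)) = hn_cc G"
    by (simp add: arrays_def stage_def hn_cc_eq_sum_weight)
  \<comment> \<open>Evaluating \<open>get 12 (Num 0)\<close> costs 30 and the assignment 1.\<close>
  show "runs W (Assign ''out'' (get 12 (Num 0))) s 31 (\<lambda>s. fst s ''out'' = hn_cc G)"
  proof (rule runs_Assign)
    show "fits W s (get 12 (Num 0))"
      using s by (intro fits_small) (auto simp: repr_def small_def)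
  qed (use v in simp_all)
qed (use sum_degrees in \<open>auto simp: algebra_simps\<close>)

end

section \<open>Input length and the final constants\<close>

lemma sum_card_nbrs_le:
  assumes G: "simple_graph G" and vs: "distinct vs" "set vs \<subseteq> verts G"
  shows "(\<Sum>i<length vs. card {j. j < length vs \<and> adjacent G (vs ! i) (vs ! j)}) \<le> 2 * card (edges G)"
proof -
  let ?n = "length vs"
  let ?P = "SIGMA i:{..<?n}. {j. j < ?n \<and> adjacent G (vs ! i) (vs ! j)}"
  \<comment> \<open>Handshaking by injection: an edge together with the order of its ends determines
    the ordered pair of indices.\<close>
  let ?f = "\<lambda>(i, j). ({vs ! i, vs ! j}, i < j)"
  have finE: "finite (edges G)"
    using G by (intro finite_subset[of "edges G" "Pow (verts G)"]) (auto simp: simple_graph_def)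
  have inj: "inj_on ?f ?P"
  proof (rule inj_onI, clarsimp)
    fix i j i' j'
    assume less: "i < ?n" "j < ?n" "i' < ?n" "j' < ?n" and adj: "adjacent G (vs ! i) (vs ! j)"
      and eq: "{vs ! i, vs ! j} = {vs ! i', vs ! j'}" and lt: "(i < j) = (i' < j')"
    have "i \<noteq> j"
      using adj G by (auto simp: adjacent_def simple_graph_def)
    moreover have "i = i' \<and> j = j' \<or> i = j' \<and> j = i'"
      using eq less vs(1) by (auto simp: doubleton_eq_iff nth_eq_iff_index_eq)
    ultimately show "i = i' \<and> j = j'"
      using lt by auto
  qed
  have "(\<Sum>i<?n. card {j. j < ?n \<and> adjacent G (vs ! i) (vs ! j)}) = card ?P"
    by (rule card_SigmaI[symmetric]) auto
  also have "\<dots> = card (?f ` ?P)"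
    by (rule card_image[OF inj, symmetric])
  also have "\<dots> \<le> card (edges G \<times> (UNIV :: bool set))"
    using finE by (intro card_mono) (auto simp: adjacent_def)
  also have "\<dots> = 2 * card (edges G)"
    by (simp add: card_cartesian_product)
  finally show ?thesis .
qed

theorem theorem7:
  shows "linear_time_computable_on (P4_sparse :: 'a ugraph \<Rightarrow> bool) hn_cc"
  unfolding linear_time_computable_on_def
proof (rule exI[of _ hull_number_com], rule exI[of _ 400000], rule exI[of _ 15], intro allI impI)
  fix G :: "'a ugraph" and xs
  assume asm: "simple_graph G \<and> P4_sparse G \<and> adjacency_lists G xs"
  then obtain vs ls where vs: "distinct vs" "set vs = verts G" "length ls = length vs"
    and ls: "\<And>i. i < length vs \<Longrightarrow> distinct (ls ! i)"
      "\<And>i. i < length vs \<Longrightarrow> set (ls ! i) = {j. j < length vs \<and> adjacent G (vs ! i) (vs ! j)}"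
    and xs: "xs = length vs # concat (map (\<lambda>l. length l # l) ls)"
    unfolding adjacency_lists_def by blast
  let ?n = "length ls" and ?W = "(graph_size G + 2) ^ 15"
  let ?B = "length xs + 13 * (?n + 1)"
  have n: "?n = card (verts G)"
    using vs distinct_card by metis
  have "length (concat (map (\<lambda>l. length l # l) ls)) = (\<Sum>i<?n. Suc (length (ls ! i)))"
    by (simp add: length_concat comp_def sum_list_sum_nth atLeast0LessThan)
  also have "\<dots> = ?n + (\<Sum>i<?n. card {j. j < ?n \<and> adjacent G (vs ! i) (vs ! j)})"
  proof -
    have "length (ls ! i) = card {j. j < ?n \<and> adjacent G (vs ! i) (vs ! j)}" if "i < ?n" for i
      using ls[of i] that vs(3) distinct_card by metis
    then show ?thesis
      by (simp add: sum_Suc)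
  qed
  finally have len: "length xs \<le> 1 + ?n + 2 * card (edges G)"
    using sum_card_nbrs_le[of G vs] asm vs xs by simp
  then have len': "length xs \<le> 2 * (graph_size G + 1)"
    using n by (simp add: graph_size_def)
  \<comment> \<open>\<open>?B\<close> is at most 14 times \<open>graph_size G + 2\<close>, and 14000
    is less than \<open>2 ^ 14\<close>. As the base \<open>graph_size G + 2\<close> is at least 2,
    fourteen factors absorb the constant and the fifteenth is the linear term.\<close>
  have "1000 * ?B \<le> 2 ^ 14 * (graph_size G + 2)"
    using len n by (simp add: graph_size_def)
  also have "\<dots> \<le> (graph_size G + 2) ^ 14 * (graph_size G + 2)"
    by (intro mult_le_mono1 power_mono) simp_all
  also have "\<dots> = ?W"
    by (subst power_Suc2[symmetric]) simp
  finally have W: "1000 * ?B \<le> ?W" .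
  have "w < ?n" if "l \<in> set ls" "w \<in> set l" for l w
    using that ls(2) vs(3) by (metis (no_types, lifting) in_set_conv_nth mem_Collect_eq)
  then interpret encoded_graph ls ?B ?W G vs
    using asm vs ls xs W by unfold_locales (auto simp: vs(3))
  have "input = xs"
    using xs vs(3) by (simp add: input_def)
  then have "runs ?W hull_number_com (init_state xs) (200000 * length xs) (\<lambda>s. fst s ''out'' = hn_cc G)"
    using runs_hull_number_com by simp
  then obtain t s where "exec ?W hull_number_com (init_state xs) t s" "t \<le> 200000 * length xs"
    "fst s ''out'' = hn_cc G"
    unfolding runs_def by blast
  \<comment> \<open>The input has at most twice \<open>graph_size G + 1\<close> entries, since each
    edge is listed at both ends; this doubles the constant.\<close>
  moreover have "200000 * length xs \<le> 400000 * (graph_size G + 1)"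
    using len' by simp
  ultimately show "\<exists>t s. exec ?W hull_number_com (init_state xs) t s \<and>
      t \<le> 400000 * (graph_size G + 1) \<and> fst s ''out'' = hn_cc G"
    using le_trans by blast
qed

end
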